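(* Let $M$ be a hypersurface of the homogeneous nearly Kähler $\mathbb{S}^6$, with shape operator $A$ and induced almost contact structure tensor $\phi$. Then $M$ satisfies $A\phi+\phi A=0$ on $M$ if and only if $M$ is totally geodesic (that is, $A=0$ identically on $M$).
   Context: The homogeneous nearly Kähler $\mathbb{S}^6$: identify $\mathbb{R}^7$ with the space of purely imaginary Cayley numbers (octonions) $\operatorname{Im}\mathbb{O}$, with its Euclidean inner product and vector cross product $u\times v=\tfrac12(uv-vu)$. Let $\mathbb{S}^6\subset\mathbb{R}^7$ be the unit sphere with the metric $g$ induced from the Euclidean metric and the almost complex structure $J$ given by $J_xv=x\times v$ for $x\in\mathbb{S}^6$, $v\in T_x\mathbb{S}^6$. Let $\tilde\nabla$ be the Levi-Civita connection of $g$. Hypersurfaces: a hypersurface $M$ is a smooth (nonempty) immersed submanifold of real dimension $5$ with the induced metric, also denoted $g$. Let $\xi$ be a (local) unit normal vector field along $M$. The shape operator $A$ is the $(1,1)$-tensor field on $M$ defined by $\tilde\nabla_X\xi=-AX$ for $X$ tangent to $M$. The tensor field $\phi$ of type $(1,1)$ is defined by letting $\phi X$ be the tangential part of $JX$, i.e. $JX=\phi X+f(X)\xi$ with $\phi X$ tangent to $M$ and $f$ a $1$-form on $M$. Replacing $\xi$ by $-\xi$ leaves $\phi$ unchanged and changes the sign of $A$, so the condition $A\phi+\phi A=0$ does not depend on the choice of $\xi$. *)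

theory Defs
  imports "HOL-Analysis.Analysis"
begin

section \<open>Octonions and the cross product\<close>

text \<open>
  Quaternions and octonions are obtained by applying the Cayley--Dickson construction
  \<open>(a, b)(c, d) = (a c - d\<^sup>* b, d a + b c\<^sup>*)\<close>, \<open>(a, b)\<^sup>* = (a\<^sup>*, - b)\<close> twice to the complex
  numbers. Addition, scaling, norm and inner product on the product types are the Euclidean ones
  of the library.
\<close>

type_synonym quat = "complex \<times> complex"
type_synonym oct = "quat \<times> quat"

definition qmult :: "quat \<Rightarrow> quat \<Rightarrow> quat" where
  "qmult x y = (fst x * fst y - cnj (snd y) * snd x, snd y * fst x + snd x * cnj (fst y))"

definition qconj :: "quat \<Rightarrow> quat" where
  "qconj x = (cnj (fst x), - snd x)"

definition omult :: "oct \<Rightarrow> oct \<Rightarrow> oct" where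
  "omult x y = (qmult (fst x) (fst y) - qmult (qconj (snd y)) (snd x),
                qmult (snd y) (fst x) + qmult (snd x) (qconj (fst y)))"

definition ImO :: "oct set" where
  "ImO = {x. Re (fst (fst x)) = 0}"

definition ocross :: "oct \<Rightarrow> oct \<Rightarrow> oct" where
  "ocross u v = (1 / 2) *\<^sub>R (omult u v - omult v u)"

text \<open>The octonions are a composition algebra for the Euclidean norm of the product type.\<close>

lemma norm_omult: "norm (omult x y) = norm x * norm y"
proof -
  have "(norm (omult x y))\<^sup>2 = (norm x)\<^sup>2 * (norm y)\<^sup>2"
    by (simp add: omult_def qmult_def qconj_def power2_norm_eq_inner inner_prod_def
        inner_complex_def) algebra
  then show ?thesis
    by (metis norm_ge_zero power2_eq_imp_eq power_mult_distrib mult_nonneg_nonneg)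
qed


section \<open>Smooth maps\<close>

text \<open>For an open set \<open>S\<close>, \<open>Ck_on k f S\<close> says that \<open>f\<close> is of class \<open>C\<^sup>k\<close> on \<open>S\<close>.\<close>

primrec Ck_on ::
  "nat \<Rightarrow> ('a::real_normed_vector \<Rightarrow> 'b::real_normed_vector) \<Rightarrow> 'a set \<Rightarrow> bool"
where
  "Ck_on 0 f S \<longleftrightarrow> continuous_on S f"
| "Ck_on (Suc k) f S \<longleftrightarrow> (\<forall>x\<in>S. f differentiable (at x)) \<and>
     (\<forall>v. Ck_on k (\<lambda>x. frechet_derivative f (at x) v) S)"

text \<open>On an arbitrary set a map is smooth if near every point it is the restriction of a map that
  is of class \<open>C\<^sup>\<infinity>\<close> on an open set of the ambient space; on open sets this is the usual notion.\<close>

definition smooth_map_on ::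
  "'a set \<Rightarrow> ('a::real_normed_vector \<Rightarrow> 'b::real_normed_vector) \<Rightarrow> bool" where
  "smooth_map_on S f \<longleftrightarrow>
     (\<forall>x\<in>S. \<exists>U g. open U \<and> x \<in> U \<and> (\<forall>k. Ck_on k g U) \<and> (\<forall>y\<in>U \<inter> S. g y = f y))"


section \<open>The unit sphere and its Levi-Civita connection\<close>

definition S6 :: "oct set" where
  "S6 = ImO \<inter> sphere 0 1"

definition tanS6 :: "oct \<Rightarrow> oct set" where
  "tanS6 x = {v \<in> ImO. v \<bullet> x = 0}"

definition J :: "oct \<Rightarrow> oct \<Rightarrow> oct" where
  "J x v = ocross x v"

text \<open>The derivative of a map on the sphere in a direction \<open>v\<close> tangent to the sphere at \<open>x\<close>. A
  derivative within the sphere is unique only on tangent vectors, so the term is meaningful only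
  for \<open>v \<in> tanS6 x\<close>.\<close>

definition dS6 :: "(oct \<Rightarrow> 'b::real_normed_vector) \<Rightarrow> oct \<Rightarrow> oct \<Rightarrow> 'b" where
  "dS6 f x v = frechet_derivative f (at x within S6) v"

definition vector_fields_S6 :: "(oct \<Rightarrow> oct) set" where
  "vector_fields_S6 = {X. smooth_map_on S6 X \<and> (\<forall>x\<in>S6. X x \<in> tanS6 x)}"

definition smooth_functions_S6 :: "(oct \<Rightarrow> real) set" where
  "smooth_functions_S6 = {f. smooth_map_on S6 f}"

text \<open>Vector fields and functions on the sphere are represented by total functions whose values
  off the sphere are irrelevant. The torsion condition
  \<open>\<nabla>\<^sub>X Y - \<nabla>\<^sub>Y X = [X, Y]\<close> is expressed by letting both sides act on functions.\<close>

definition affine_connection_S6 :: "((oct \<Rightarrow> oct) \<Rightarrow> (oct \<Rightarrow> oct) \<Rightarrow> oct \<Rightarrow> oct) \<Rightarrow> bool" where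
  "affine_connection_S6 nabla \<longleftrightarrow>
     (\<forall>X\<in>vector_fields_S6. \<forall>Y\<in>vector_fields_S6. nabla X Y \<in> vector_fields_S6) \<and>
     (\<forall>X\<in>vector_fields_S6. \<forall>X'\<in>vector_fields_S6. \<forall>Y\<in>vector_fields_S6. \<forall>x\<in>S6.
        nabla (\<lambda>y. X y + X' y) Y x = nabla X Y x + nabla X' Y x) \<and>
     (\<forall>f\<in>smooth_functions_S6. \<forall>X\<in>vector_fields_S6. \<forall>Y\<in>vector_fields_S6. \<forall>x\<in>S6.
        nabla (\<lambda>y. f y *\<^sub>R X y) Y x = f x *\<^sub>R nabla X Y x) \<and>
     (\<forall>X\<in>vector_fields_S6. \<forall>Y\<in>vector_fields_S6. \<forall>Y'\<in>vector_fields_S6. \<forall>x\<in>S6.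
        nabla X (\<lambda>y. Y y + Y' y) x = nabla X Y x + nabla X Y' x) \<and>
     (\<forall>f\<in>smooth_functions_S6. \<forall>X\<in>vector_fields_S6. \<forall>Y\<in>vector_fields_S6. \<forall>x\<in>S6.
        nabla X (\<lambda>y. f y *\<^sub>R Y y) x = dS6 f x (X x) *\<^sub>R Y x + f x *\<^sub>R nabla X Y x)"

definition torsion_free_S6 :: "((oct \<Rightarrow> oct) \<Rightarrow> (oct \<Rightarrow> oct) \<Rightarrow> oct \<Rightarrow> oct) \<Rightarrow> bool" where
  "torsion_free_S6 nabla \<longleftrightarrow>
     (\<forall>X\<in>vector_fields_S6. \<forall>Y\<in>vector_fields_S6. \<forall>f\<in>smooth_functions_S6. \<forall>x\<in>S6.
        dS6 f x (nabla X Y x - nabla Y X x)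
          = dS6 (\<lambda>y. dS6 f y (Y y)) x (X x) - dS6 (\<lambda>y. dS6 f y (X y)) x (Y x))"

definition metric_S6 :: "((oct \<Rightarrow> oct) \<Rightarrow> (oct \<Rightarrow> oct) \<Rightarrow> oct \<Rightarrow> oct) \<Rightarrow> bool" where
  "metric_S6 nabla \<longleftrightarrow>
     (\<forall>X\<in>vector_fields_S6. \<forall>Y\<in>vector_fields_S6. \<forall>Z\<in>vector_fields_S6. \<forall>x\<in>S6.
        dS6 (\<lambda>y. Y y \<bullet> Z y) x (X x) = nabla X Y x \<bullet> Z x + Y x \<bullet> nabla X Z x)"

definition levi_civita_S6 :: "((oct \<Rightarrow> oct) \<Rightarrow> (oct \<Rightarrow> oct) \<Rightarrow> oct \<Rightarrow> oct) \<Rightarrow> bool" where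
  "levi_civita_S6 nabla \<longleftrightarrow>
     affine_connection_S6 nabla \<and> torsion_free_S6 nabla \<and> metric_S6 nabla"


section \<open>Smooth manifolds\<close>

text \<open>A chart is a pair of its domain and a map that matters only on the domain. A manifold is given
  by its topology and an atlas, not necessarily maximal.\<close>

type_synonym ('a, 'e) chart = "'a set \<times> ('a \<Rightarrow> 'e)"

definition in_chart :: "('a, 'e) chart \<Rightarrow> ('a \<Rightarrow> 'b) \<Rightarrow> 'e \<Rightarrow> 'b" where
  "in_chart c f = f \<circ> inv_into (fst c) (snd c)"

definition smooth_manifold ::
  "'a topology \<Rightarrow> ('a, 'e::euclidean_space) chart set \<Rightarrow> bool" where
  "smooth_manifold T Atl \<longleftrightarrow>
     Hausdorff_space T \<and> second_countable T \<and>
     (\<Union>c\<in>Atl. fst c) = topspace T \<and>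
     (\<forall>(U, h)\<in>Atl. openin T U \<and> open (h ` U) \<and>
        homeomorphic_map (subtopology T U) (top_of_set (h ` U)) h) \<and>
     (\<forall>(U, h)\<in>Atl. \<forall>(V, k)\<in>Atl. smooth_map_on (h ` (U \<inter> V)) (in_chart (U, h) k))"

definition smooth_on_mfd ::
  "('a, 'e::euclidean_space) chart set \<Rightarrow> 'a set \<Rightarrow> ('a \<Rightarrow> 'b::real_normed_vector) \<Rightarrow> bool" where
  "smooth_on_mfd Atl W f \<longleftrightarrow> (\<forall>(U, h)\<in>Atl. smooth_map_on (h ` (U \<inter> W)) (in_chart (U, h) f))"

text \<open>The derivative of \<open>f\<close> at \<open>p\<close> in the direction of the tangent vector that has the coordinates
  \<open>u\<close> in the chart \<open>c\<close>.\<close>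

definition d_chart ::
  "('a, 'e::euclidean_space) chart \<Rightarrow> ('a \<Rightarrow> 'b::real_normed_vector) \<Rightarrow> 'a \<Rightarrow> 'e \<Rightarrow> 'b" where
  "d_chart c f p u = frechet_derivative (in_chart c f) (at (snd c p)) u"


section \<open>Hypersurfaces of the sphere\<close>

text \<open>A hypersurface is a nonempty smooth 5-manifold with an immersion \<open>F\<close> into the sphere.\<close>

definition hypersurface_S6 ::
  "'a topology \<Rightarrow> ('a, real^5) chart set \<Rightarrow> ('a \<Rightarrow> oct) \<Rightarrow> bool" where
  "hypersurface_S6 T Atl F \<longleftrightarrow>
     smooth_manifold T Atl \<and> topspace T \<noteq> {} \<and>
     F ` topspace T \<subseteq> S6 \<and> smooth_on_mfd Atl (topspace T) F \<and>
     (\<forall>c\<in>Atl. \<forall>p\<in>fst c. inj (d_chart c F p))"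

text \<open>As usual for immersed submanifolds, the tangent space at \<open>p\<close> is identified with its image under
  the derivative of the immersion, a subspace of the tangent space of the sphere at \<open>F p\<close>. The
  induced metric is then the restriction of the Euclidean inner product.\<close>

definition tanM :: "('a, real^5) chart set \<Rightarrow> ('a \<Rightarrow> oct) \<Rightarrow> 'a \<Rightarrow> oct set" where
  "tanM Atl F p = {d_chart c F p u | c u. c \<in> Atl \<and> p \<in> fst c}"

text \<open>\<open>xi\<close> is a unit normal vector field on the open set \<open>W\<close> of the hypersurface.\<close>

definition unit_normal_on ::
  "'a topology \<Rightarrow> ('a, real^5) chart set \<Rightarrow> ('a \<Rightarrow> oct) \<Rightarrow> 'a set \<Rightarrow> ('a \<Rightarrow> oct) \<Rightarrow> bool" where
  "unit_normal_on T Atl F W xi \<longleftrightarrow>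
     openin T W \<and> smooth_on_mfd Atl W xi \<and>
     (\<forall>p\<in>W. xi p \<in> tanS6 (F p) \<and> norm (xi p) = 1 \<and> (\<forall>v\<in>tanM Atl F p. xi p \<bullet> v = 0))"

text \<open>
  The covariant derivative of a vector field \<open>xi\<close> along the immersion, i.e. the pull-back of the
  connection of the sphere: if \<open>xi = (\<Sum>i<n. a\<^sub>i (E\<^sub>i \<circ> F))\<close> near \<open>p\<close> with smooth functions \<open>a\<^sub>i\<close> on
  the hypersurface and vector fields \<open>E\<^sub>i\<close> on the sphere, then
  \<open>\<nabla>\<^sub>v xi = (\<Sum>i<n. v(a\<^sub>i) E\<^sub>i + a\<^sub>i \<nabla>\<^sub>v E\<^sub>i)\<close>, where \<open>\<nabla>\<^sub>v E\<^sub>i\<close> is evaluated by extending \<open>v\<close> to a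
  vector field \<open>X\<close> on the sphere. The value does not depend on the choices.
\<close>

definition is_cov_along ::
  "((oct \<Rightarrow> oct) \<Rightarrow> (oct \<Rightarrow> oct) \<Rightarrow> oct \<Rightarrow> oct) \<Rightarrow> 'a topology \<Rightarrow> ('a, real^5) chart set
     \<Rightarrow> ('a \<Rightarrow> oct) \<Rightarrow> ('a \<Rightarrow> oct) \<Rightarrow> 'a \<Rightarrow> oct \<Rightarrow> oct \<Rightarrow> bool" where
  "is_cov_along nabla T Atl F xi p v w \<longleftrightarrow>
     (\<exists>N c u X (n::nat) (a :: nat \<Rightarrow> 'a \<Rightarrow> real) E.
        openin T N \<and> p \<in> N \<and>
        c \<in> Atl \<and> p \<in> fst c \<and> d_chart c F p u = v \<and>
        X \<in> vector_fields_S6 \<and> X (F p) = v \<and>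
        (\<forall>i<n. smooth_on_mfd Atl N (a i) \<and> E i \<in> vector_fields_S6) \<and>
        (\<forall>q\<in>N. xi q = (\<Sum>i<n. a i q *\<^sub>R E i (F q))) \<and>
        w = (\<Sum>i<n. d_chart c (a i) p u *\<^sub>R E i (F p) + a i p *\<^sub>R nabla X (E i) (F p)))"

definition cov_along ::
  "((oct \<Rightarrow> oct) \<Rightarrow> (oct \<Rightarrow> oct) \<Rightarrow> oct \<Rightarrow> oct) \<Rightarrow> 'a topology \<Rightarrow> ('a, real^5) chart set
     \<Rightarrow> ('a \<Rightarrow> oct) \<Rightarrow> ('a \<Rightarrow> oct) \<Rightarrow> 'a \<Rightarrow> oct \<Rightarrow> oct" where
  "cov_along nabla T Atl F xi p v = (THE w. is_cov_along nabla T Atl F xi p v w)"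

definition shape_op ::
  "((oct \<Rightarrow> oct) \<Rightarrow> (oct \<Rightarrow> oct) \<Rightarrow> oct \<Rightarrow> oct) \<Rightarrow> 'a topology \<Rightarrow> ('a, real^5) chart set
     \<Rightarrow> ('a \<Rightarrow> oct) \<Rightarrow> ('a \<Rightarrow> oct) \<Rightarrow> 'a \<Rightarrow> oct \<Rightarrow> oct" where
  "shape_op nabla T Atl F xi p v = - cov_along nabla T Atl F xi p v"

definition phi ::
  "('a, real^5) chart set \<Rightarrow> ('a \<Rightarrow> oct) \<Rightarrow> ('a \<Rightarrow> oct) \<Rightarrow> 'a \<Rightarrow> oct \<Rightarrow> oct" where
  "phi Atl F xi p v =
     (THE w. w \<in> tanM Atl F p \<and> (\<exists>f::real. J (F p) v = w + f *\<^sub>R xi p))"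

text \<open>Both conditions are imposed for every local unit normal field; such fields exist near every
  point.\<close>

definition anticommuting ::
  "((oct \<Rightarrow> oct) \<Rightarrow> (oct \<Rightarrow> oct) \<Rightarrow> oct \<Rightarrow> oct) \<Rightarrow> 'a topology \<Rightarrow> ('a, real^5) chart set
     \<Rightarrow> ('a \<Rightarrow> oct) \<Rightarrow> bool" where
  "anticommuting nabla T Atl F \<longleftrightarrow>
     (\<forall>W xi. unit_normal_on T Atl F W xi \<longrightarrow> (\<forall>p\<in>W. \<forall>v\<in>tanM Atl F p.
        shape_op nabla T Atl F xi p (phi Atl F xi p v)
          + phi Atl F xi p (shape_op nabla T Atl F xi p v) = 0))"

definition totally_geodesic ::
  "((oct \<Rightarrow> oct) \<Rightarrow> (oct \<Rightarrow> oct) \<Rightarrow> oct \<Rightarrow> oct) \<Rightarrow> 'a topology \<Rightarrow> ('a, real^5) chart set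
     \<Rightarrow> ('a \<Rightarrow> oct) \<Rightarrow> bool" where
  "totally_geodesic nabla T Atl F \<longleftrightarrow>
     (\<forall>W xi. unit_normal_on T Atl F W xi \<longrightarrow> (\<forall>p\<in>W. \<forall>v\<in>tanM Atl F p.
        shape_op nabla T Atl F xi p v = 0))"

end

theory Submission
  imports Defs
begin

text \<open>
  Write \<open>x\<close> for a point of the hypersurface, \<open>n\<close> for the unit normal there, \<open>A\<close> for the shape operator
  and \<open>\<times>\<close> for the cross product. Let \<open>U = x \<times> n\<close>, which is tangent to the hypersurface, and let \<open>D\<close> be
  the 4-dimensional orthogonal complement of \<open>U\<close> in the tangent space.

  Suppose \<open>A \<phi> + \<phi> A = 0\<close>. Since \<open>\<phi> U = 0\<close> and the kernel of \<open>\<phi>\<close> is spanned by \<open>U\<close>, the vector \<open>U\<close> is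
  principal, \<open>A U = \<alpha> U\<close>, at every point. On \<open>D\<close> the tensor \<open>\<phi>\<close> is \<open>J\<close>, so \<open>A J = - J A\<close> there. As
  \<open>A\<close> is symmetric, the equation \<open>A U = \<alpha> U\<close> says that the one-form \<open>\<langle>dn, x \<times> n\<rangle>\<close> equals
  \<open>- \<alpha> \<langle>dx, x \<times> n\<rangle>\<close>. Its exterior derivative (in which second derivatives cancel; this is
  where the Codazzi equation enters) gives, for \<open>X\<close> and \<open>Y\<close> in \<open>D\<close>,
  \<open>\<langle>A Y, X \<times> n\<rangle> - \<langle>A X, Y \<times> n\<rangle> + 2 \<langle>A X, J A Y\<rangle> = - 2 \<alpha> \<langle>X, Y \<times> n\<rangle>\<close>.
  With \<open>Y = J X\<close> and \<open>K X = x \<times> (X \<times> n)\<close> this becomes \<open>|A X|\<^sup>2 = - \<langle>A X, K X\<rangle>\<close>. As \<open>K\<^sup>2 = - 1\<close> on \<open>D\<close> and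
  \<open>A\<close> is symmetric, the right-hand sides for \<open>X\<close> and for \<open>K X\<close> cancel, so \<open>|A X|\<^sup>2 + |A (K X)|\<^sup>2 = 0\<close>.
  Thus \<open>A\<close> vanishes on \<open>D\<close>, and then \<open>Y = X \<times> n\<close> gives \<open>\<alpha> = 0\<close>. The linear algebra is
  \<open>anticommuting_shape_vanishes\<close>, the exterior derivative is \<open>deriv_of_proportional_forms\<close>, and the two are
  combined in \<open>anticommuting_imp_shape_op_zero\<close>. The converse is immediate.

  This argument computes with flat derivatives in the octonions. It applies because the Levi-Civita
  connection is the tangential part of the flat derivative (\<open>levi_civita_S6_eq_tan_proj\<close>) and the
  flat derivative of \<open>n\<close> is already tangent to the sphere, so that \<open>A (dF u) = - dn u\<close>
  (\<open>shape_op_eq\<close>).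
\<close>


section \<open>Algebra of the cross product\<close>

definition octone :: oct where
  "octone = ((1, 0), (0, 0))"

lemma ImO_iff: "x \<in> ImO \<longleftrightarrow> x \<bullet> octone = 0"
  by (simp add: ImO_def octone_def inner_prod_def inner_complex_def)

lemma octone_unit: "octone \<bullet> octone = 1"
  by (simp add: octone_def inner_prod_def inner_complex_def)

lemma ocross_in_ImO: "ocross a b \<in> ImO"
  by (simp add: ImO_def ocross_def omult_def qmult_def qconj_def algebra_simps)

lemma ocross_antisym: "ocross a b = - ocross b a"
  by (simp add: ocross_def scaleR_diff_right)

lemma inner_ocross_cyclic: "ocross a b \<bullet> c = ocross b c \<bullet> a"
  by (simp add: ocross_def omult_def qmult_def qconj_def inner_prod_def inner_complex_def) algebra

lemma ocross_self: "ocross a a = 0"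
  by (simp add: ocross_def)

lemma inner_ocross_move_left: "ocross a b \<bullet> c = - (b \<bullet> ocross a c)"
  using inner_ocross_cyclic[of a b c] inner_ocross_cyclic[of b c a] ocross_antisym[of c a]
  by (simp add: inner_commute)

lemma inner_ocross_move_right: "ocross a b \<bullet> c = - (a \<bullet> ocross c b)"
  using inner_ocross_move_left[of b a c] ocross_antisym[of a b] ocross_antisym[of b c]
  by simp

lemma ocross_orthogonal: "ocross a b \<bullet> a = 0" "ocross a b \<bullet> b = 0"
  using inner_ocross_move_left[of a b b] inner_ocross_move_right[of a b a]
  by (simp_all add: inner_commute)

lemma bilinear_ocross: "bilinear ocross"
  unfolding bilinear_def ocross_def omult_def qmult_def qconj_def
  by (auto intro!: linearI simp: prod_eq_iff complex_eq_iff algebra_simps)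

lemma bounded_bilinear_ocross: "bounded_bilinear ocross"
  using bilinear_ocross bilinear_conv_bounded_bilinear by blast

interpretation ocross: bounded_bilinear ocross
  by (rule bounded_bilinear_ocross)

text \<open>The Lagrange identity, polarised in the second factor. As \<open>c\<close> ranges over all octonions, the identity
  can be used to compare vectors.\<close>

lemma inner_ocross_ocross:
  assumes "a \<in> ImO" "b \<in> ImO"
  shows "ocross a b \<bullet> ocross a c = (a \<bullet> a) * (b \<bullet> c) - (a \<bullet> b) * (a \<bullet> c)"
proof -
  have "(omult a b - omult b a) \<bullet> (omult a c - omult c a)
      = 4 * ((a \<bullet> a) * (b \<bullet> c) - (a \<bullet> b) * (a \<bullet> c))"
  proof -
    obtain a1 a2 a3 a4 a5 a6 a7 where a: "a = ((Complex 0 a1, Complex a2 a3), (Complex a4 a5, Complex a6 a7))"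
      using assms(1) unfolding ImO_def by (cases a; force simp: complex_eq_iff)
    obtain b1 b2 b3 b4 b5 b6 b7 where b: "b = ((Complex 0 b1, Complex b2 b3), (Complex b4 b5, Complex b6 b7))"
      using assms(2) unfolding ImO_def by (cases b; force simp: complex_eq_iff)
    obtain c0 c1 c2 c3 c4 c5 c6 c7 where c: "c = ((Complex c0 c1, Complex c2 c3), (Complex c4 c5, Complex c6 c7))"
      by (metis complex.exhaust prod.exhaust)
    show ?thesis
      unfolding a b c
      apply (simp add: omult_def qmult_def qconj_def inner_prod_def inner_complex_def)
      apply algebra
      done
  qed
  then show ?thesis
    by (simp add: ocross_def)
qed

lemma ocross_twice:
  assumes "a \<in> ImO" "b \<in> ImO"
  shows "ocross a (ocross a b) = (a \<bullet> b) *\<^sub>R a - (a \<bullet> a) *\<^sub>R b"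
proof (rule vector_eq_rdot[THEN iffD1], rule allI)
  fix c
  have "ocross a (ocross a b) \<bullet> c = - (ocross a b \<bullet> ocross a c)"
    by (rule inner_ocross_move_left)
  then show "ocross a (ocross a b) \<bullet> c = ((a \<bullet> b) *\<^sub>R a - (a \<bullet> a) *\<^sub>R b) \<bullet> c"
    using assms by (simp add: inner_ocross_ocross inner_diff_left)
qed

text \<open>Polarising \<open>a \<times> (a \<times> b) = - |a|\<^sup>2 b\<close> in \<open>a\<close> shows that orthogonal imaginary octonions
  anti-associate.\<close>

lemma ocross_anti_assoc:
  assumes "a \<in> ImO" "b \<in> ImO" "c \<in> ImO" "a \<bullet> b = 0" "b \<bullet> c = 0" "a \<bullet> c = 0"
  shows "ocross (ocross a b) c = - ocross a (ocross b c)"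
proof -
  have sum: "a + c \<in> ImO"
    using assms by (simp add: ImO_def)
  have 1: "ocross (a + c) (ocross (a + c) b) = - ((a \<bullet> a + c \<bullet> c) *\<^sub>R b)"
    using ocross_twice[OF sum assms(2)] assms by (simp add: inner_simps inner_commute)
  have 2: "ocross a (ocross a b) = - ((a \<bullet> a) *\<^sub>R b)" "ocross c (ocross c b) = - ((c \<bullet> c) *\<^sub>R b)"
    using ocross_twice assms by (simp_all add: inner_commute)
  have "ocross a (ocross c b) + ocross c (ocross a b) = 0"
  proof -
    have "ocross (a + c) (ocross (a + c) b)
      = ocross a (ocross a b) + ocross c (ocross c b) + (ocross a (ocross c b) + ocross c (ocross a b))"
      by (simp add: ocross.add_left ocross.add_right)
    then show ?thesis
      using 1 2 by (simp add: scaleR_add_left)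
  qed
  then show ?thesis
    using ocross_antisym[of c "ocross a b"] ocross_antisym[of c b]
    by (simp add: ocross.minus_right eq_neg_iff_add_eq_0 add.commute)
qed


section \<open>The shape operator at one point\<close>

text \<open>Here \<open>T\<close> is the tangent space of the hypersurface at \<open>x\<close>. On \<open>D\<close> the maps \<open>x \<times> _\<close> and \<open>_ \<times> n\<close> are
  complex structures and, up to sign, \<open>K\<close> is their product in either order, hence a third one. The
  assumption \<open>codazzi\<close> for \<open>w = x \<times> v\<close> expresses \<open>|A v|\<^sup>2\<close> by \<open>\<langle>A v, K v\<rangle>\<close>, and the symmetry of
  \<open>A\<close> makes this product change sign when \<open>K v\<close> takes the place of \<open>v\<close>.\<close>

lemma anticommuting_shape_vanishes:
  fixes A :: "oct \<Rightarrow> oct" and x n :: oct and \<alpha> :: real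
  defines "T \<equiv> {v \<in> ImO. v \<bullet> x = 0 \<and> v \<bullet> n = 0}"
  defines "D \<equiv> {v \<in> T. v \<bullet> ocross x n = 0}"
  assumes x: "x \<in> ImO" "x \<bullet> x = 1" and n: "n \<in> ImO" "n \<bullet> n = 1" and xn: "x \<bullet> n = 0"
    and A_T: "\<And>v. v \<in> T \<Longrightarrow> A v \<in> T"
    and A_sym: "\<And>v w. v \<in> T \<Longrightarrow> w \<in> T \<Longrightarrow> A v \<bullet> w = v \<bullet> A w"
    and A_U: "A (ocross x n) = \<alpha> *\<^sub>R ocross x n"
    and A_J: "\<And>v. v \<in> D \<Longrightarrow> A (ocross x v) = - ocross x (A v)"
    and codazzi: "\<And>v w. v \<in> D \<Longrightarrow> w \<in> D \<Longrightarrow>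
      A w \<bullet> ocross v n - A v \<bullet> ocross w n + 2 * (A v \<bullet> ocross x (A w))
        = - 2 * \<alpha> * (v \<bullet> ocross w n)"
    and v: "v \<in> T"
  shows "A v = 0"
proof -
  define K where "K X = ocross x (ocross X n)" for X
  have U_T: "ocross x n \<in> T"
    unfolding T_def by (simp add: ocross_in_ImO ocross_orthogonal)
  have A_D: "A X \<in> D" if "X \<in> D" for X
    using A_sym[of X "ocross x n"] A_U U_T A_T[of X] that
    by (simp add: D_def)
  have ImO: "X \<in> ImO" if "X \<in> D" for X
    using that by (simp add: D_def T_def)
  have D_perp: "X \<bullet> x = 0" "X \<bullet> n = 0" "X \<bullet> ocross x n = 0" if "X \<in> D" for X
    using that by (simp_all add: D_def T_def)
  have JJ: "ocross x (ocross x X) = - X" if "X \<in> D" for X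
    using ocross_twice[OF x(1) ImO[OF that]] D_perp[OF that] x by (simp add: inner_commute)
  have NN: "ocross (ocross X n) n = - X" if "X \<in> D" for X
    using ocross_twice[OF n(1) ImO[OF that]] D_perp[OF that] n ocross_antisym[of X n]
      ocross_antisym[of "ocross X n" n]
    by (simp add: inner_commute ocross.minus_right)
  have J_D: "ocross x X \<in> D" if "X \<in> D" for X
    using D_perp[OF that] inner_ocross_move_left[of x X n] inner_ocross_move_left[of x X "ocross x n"] ocross_twice[OF x(1) n(1)]
    by (simp add: D_def T_def ocross_in_ImO ocross_orthogonal inner_diff_right xn x)
  have N_D: "ocross X n \<in> D" if "X \<in> D" for X
  proof -
    have "ocross X n \<bullet> x = - (X \<bullet> ocross x n)"
      by (rule inner_ocross_move_right)
    moreover have "ocross X n \<bullet> ocross x n = - (ocross n X \<bullet> ocross x n)"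
      by (metis ocross_antisym inner_minus_left)
    moreover have "ocross n X \<bullet> ocross x n = X \<bullet> ocross n (ocross n x)"
      using inner_ocross_move_left[of n X "ocross x n"] ocross_antisym[of x n] by (simp add: ocross.minus_right)
    moreover have "ocross n (ocross n x) = - x"
      using ocross_twice[OF n(1) x(1)] xn n by (simp add: inner_commute)
    ultimately show ?thesis
      using D_perp[OF that] by (simp add: D_def T_def ocross_in_ImO ocross_orthogonal)
  qed
  have JN: "ocross (ocross x X) n = - K X" if "X \<in> D" for X
    unfolding K_def using ocross_anti_assoc[OF x(1) ImO[OF that] n(1)] D_perp[OF that] xn
    by (simp add: inner_commute)
  have K_D: "K X \<in> D" if "X \<in> D" for X
    unfolding K_def using that J_D N_D by blast
  have KK: "K (K X) = - X" if "X \<in> D" for X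
  proof -
    have "K (K X) = ocross x (ocross (ocross x (ocross X n)) n)"
      by (simp add: K_def)
    also have "\<dots> = - ocross x (ocross x (ocross (ocross X n) n))"
      using JN[OF N_D[OF that]] by (simp add: K_def ocross.minus_right)
    also have "\<dots> = - X"
      using NN[OF that] JJ[OF that] by (simp add: ocross.minus_right)
    finally show ?thesis .
  qed
  have XKX: "X \<bullet> K X = 0" if "X \<in> D" for X
  proof -
    have "X \<bullet> K X = - (ocross x X \<bullet> ocross X n)"
      using inner_ocross_move_left[of x X "ocross X n"] by (simp add: K_def)
    also have "ocross x X \<bullet> ocross X n = - (X \<bullet> ocross (ocross x X) n)"
      using inner_ocross_move_right[of X n "ocross x X"] by (metis inner_commute)
    also have "\<dots> = X \<bullet> K X"
      by (simp only: JN[OF that] inner_minus_right minus_minus)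
    finally show ?thesis
      by simp
  qed
  \<comment> \<open>For \<open>w = x \<times> v\<close> the right-hand side of the hypothesis vanishes, since \<open>K\<close> is skew.\<close>
  have key: "(norm (A X))\<^sup>2 = - (A X \<bullet> K X)" if "X \<in> D" for X
  proof -
    have "A X \<bullet> ocross x (A (ocross x X)) = (norm (A X))\<^sup>2"
      using A_J[OF that] JJ[OF A_D[OF that]] by (simp add: ocross.minus_right power2_norm_eq_inner)
    moreover have "A (ocross x X) \<bullet> ocross X n = A X \<bullet> K X"
      using A_J[OF that] inner_ocross_move_left[of x "A X" "ocross X n"] by (simp add: K_def)
    moreover have "A X \<bullet> ocross (ocross x X) n = - (A X \<bullet> K X)" "X \<bullet> ocross (ocross x X) n = 0"
      using JN[OF that] XKX[OF that] by simp_all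
    ultimately show ?thesis
      using codazzi[OF that J_D[OF that]] by simp
  qed
  have A_zero_D: "A X = 0" if "X \<in> D" for X
  proof -
    have T: "X \<in> T" "K X \<in> T"
      using that K_D[OF that] by (simp_all add: D_def)
    have "(norm (A X))\<^sup>2 + (norm (A (K X)))\<^sup>2 = 0"
      using key[OF that] key[OF K_D[OF that]] KK[OF that] A_sym[OF T]
      by (simp add: inner_commute)
    then show ?thesis
      by (simp add: sum_power2_eq_zero_iff)
  qed
  obtain X where X: "X \<in> D" "X \<noteq> 0"
  proof -
    have "dim (span {octone, x, n, ocross x n}) \<le> card {octone, x, n, ocross x n}"
      by (simp add: dim_le_card')
    also have "\<dots> \<le> 4"
      by (intro card_insert_le_m1) simp_all
    also have "\<dots> < DIM(oct)"
      by simp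
    finally have "dim {octone, x, n, ocross x n} < DIM(oct)"
      by simp
    then obtain X
      where "X \<noteq> 0" "\<And>y. y \<in> span {octone, x, n, ocross x n} \<Longrightarrow> orthogonal X y"
      by (rule orthogonal_to_subspace_exists) blast
    then have "X \<noteq> 0" "X \<bullet> octone = 0" "X \<bullet> x = 0" "X \<bullet> n = 0" "X \<bullet> ocross x n = 0"
      by (simp_all add: span_base orthogonal_def)
    moreover from this have "X \<in> ImO"
      by (simp add: ImO_iff)
    ultimately show ?thesis
      using that by (simp add: D_def T_def)
  qed
  \<comment> \<open>Now every term with \<open>A\<close> vanishes, and \<open>w = X \<times> n\<close> makes the remaining one definite.\<close>
  have "\<alpha> * (X \<bullet> X) = 0"
    using codazzi[OF X(1) N_D[OF X(1)]] A_zero_D X N_D[OF X(1)] NN[OF X(1)]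
    by simp
  with X have "\<alpha> = 0"
    by simp
  \<comment> \<open>A tangent \<open>v\<close> need not lie in \<open>D\<close>, but \<open>A v\<close> does; so \<open>|A v|\<^sup>2 = \<langle>v, A (A v)\<rangle> = 0\<close>.\<close>
  then have "A v \<in> D"
    using A_T[OF v] A_sym[OF v U_T] A_U by (simp add: D_def)
  then have "A v \<bullet> A v = 0"
    using A_sym[OF v, of "A v"] A_zero_D by (simp add: D_def)
  then show ?thesis
    by simp
qed


section \<open>Maps of class \<open>C\<^sup>k\<close>\<close>

lemma Ck_on_subset: "Ck_on k f S \<Longrightarrow> T \<subseteq> S \<Longrightarrow> Ck_on k f T"
  by (induction k arbitrary: f) (auto intro: continuous_on_subset)

lemma Ck_on_has_derivative:
  assumes "Ck_on (Suc k) f S" "x \<in> S"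
  shows "(f has_derivative frechet_derivative f (at x)) (at x)"
  using assms by (simp add: frechet_derivative_works[symmetric])

text \<open>Openness matters: otherwise values off \<open>S\<close> would affect the derivatives at points of \<open>S\<close>. This
  lemma turns the pointwise rules of differentiation into the rules for \<open>Ck_on\<close> below.\<close>

lemma Ck_on_cong:
  assumes "open S" "\<And>x. x \<in> S \<Longrightarrow> f x = g x" "Ck_on k f S"
  shows "Ck_on k g S"
  using assms(2,3)
proof (induction k arbitrary: f g)
  case 0
  then show ?case
    by (auto cong: continuous_on_cong)
next
  case (Suc k)
  have D: "(g has_derivative frechet_derivative f (at x)) (at x)" if "x \<in> S" for x
    by (rule has_derivative_transform_within_open
        [OF Ck_on_has_derivative[OF Suc.prems(2) that] assms(1) that Suc.prems(1)])
  have "Ck_on k (\<lambda>x. frechet_derivative g (at x) v) S" for v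
  proof (rule Suc.IH)
    show "Ck_on k (\<lambda>x. frechet_derivative f (at x) v) S"
      using Suc.prems(2) by simp
  qed (simp add: frechet_derivative_at[OF D, symmetric])
  with D show ?case
    by (auto simp: differentiable_def)
qed

lemma Ck_on_Suc_imp: "Ck_on (Suc k) f S \<Longrightarrow> Ck_on k f S"
proof (induction k arbitrary: f)
  case 0
  then show ?case
    by (auto intro!: continuous_at_imp_continuous_on differentiable_imp_continuous_within)
next
  case (Suc k)
  then show ?case
    by (simp only: Ck_on.simps) blast
qed

lemma Ck_on_const: "Ck_on k (\<lambda>x. c) S"
  by (induction k arbitrary: c) simp_all

lemma Ck_on_bounded_linear_compose:
  assumes "bounded_linear L" "open S" "Ck_on k f S"
  shows "Ck_on k (\<lambda>x. L (f x)) S"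
  using assms(3)
proof (induction k arbitrary: f)
  case 0
  then show ?case
    by (simp add: bounded_linear.continuous_on[OF assms(1)])
next
  case (Suc k)
  have D: "((\<lambda>x. L (f x)) has_derivative (\<lambda>v. L (frechet_derivative f (at x) v))) (at x)"
    if "x \<in> S" for x
    by (rule bounded_linear.has_derivative[OF assms(1) Ck_on_has_derivative[OF Suc.prems that]])
  have "Ck_on k (\<lambda>x. L (frechet_derivative f (at x) v)) S" for v
    using Suc.IH Suc.prems by simp
  then have "Ck_on k (\<lambda>x. frechet_derivative (\<lambda>x. L (f x)) (at x) v) S" for v
    by (rule Ck_on_cong[OF assms(2), rotated]) (simp add: frechet_derivative_at[OF D, symmetric])
  with D show ?case
    by (auto simp: differentiable_def)
qed

lemma Ck_on_add:
  assumes "open S" "Ck_on k f S" "Ck_on k g S"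
  shows "Ck_on k (\<lambda>x. f x + g x) S"
  using assms(2,3)
proof (induction k arbitrary: f g)
  case 0
  then show ?case
    by (simp add: continuous_on_add)
next
  case (Suc k)
  have D: "((\<lambda>x. f x + g x) has_derivative
      (\<lambda>v. frechet_derivative f (at x) v + frechet_derivative g (at x) v)) (at x)"
    if "x \<in> S" for x
    by (intro has_derivative_add Ck_on_has_derivative[OF Suc.prems(1) that]
        Ck_on_has_derivative[OF Suc.prems(2) that])
  have "Ck_on k (\<lambda>x. frechet_derivative f (at x) v + frechet_derivative g (at x) v) S" for v
    using Suc.IH Suc.prems by simp
  then have "Ck_on k (\<lambda>x. frechet_derivative (\<lambda>x. f x + g x) (at x) v) S" for v
    by (rule Ck_on_cong[OF assms(1), rotated]) (simp add: frechet_derivative_at[OF D, symmetric])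
  with D show ?case
    by (auto simp: differentiable_def)
qed

lemma Ck_on_bilinear:
  assumes "bounded_bilinear B" "open S" "Ck_on k f S" "Ck_on k g S"
  shows "Ck_on k (\<lambda>x. B (f x) (g x)) S"
  using assms(3,4)
proof (induction k arbitrary: f g)
  case 0
  then show ?case
    by (simp add: bounded_bilinear.continuous_on[OF assms(1)])
next
  case (Suc k)
  have D: "((\<lambda>x. B (f x) (g x)) has_derivative
      (\<lambda>v. B (f x) (frechet_derivative g (at x) v) + B (frechet_derivative f (at x) v) (g x))) (at x)"
    if "x \<in> S" for x
    by (rule bounded_bilinear.FDERIV[OF assms(1) Ck_on_has_derivative[OF Suc.prems(1) that]
        Ck_on_has_derivative[OF Suc.prems(2) that]])
  have "Ck_on k (\<lambda>x. B (f x) (frechet_derivative g (at x) v)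
      + B (frechet_derivative f (at x) v) (g x)) S" for v
    using Suc.prems by (intro Ck_on_add[OF assms(2)] Suc.IH Ck_on_Suc_imp[of k f] Ck_on_Suc_imp[of k g]) auto
  then have "Ck_on k (\<lambda>x. frechet_derivative (\<lambda>x. B (f x) (g x)) (at x) v) S" for v
    by (rule Ck_on_cong[OF assms(2), rotated]) (simp add: frechet_derivative_at[OF D, symmetric])
  with D show ?case
    by (auto simp: differentiable_def)
qed

lemma Ck_on_ident: "Ck_on k (\<lambda>x. x) S"
  by (cases k) (simp_all add: Ck_on_const)

lemma smooth_map_on_open:
  assumes "smooth_map_on S f" "open S" "x \<in> S"
  obtains U where "open U" "x \<in> U" "U \<subseteq> S" "\<And>k. Ck_on k f U"
proof -
  obtain V g where V: "open V" "x \<in> V" "\<forall>k. Ck_on k g V" "\<forall>y\<in>V \<inter> S. g y = f y"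
    using assms(1,3) unfolding smooth_map_on_def by meson
  have "Ck_on k f (V \<inter> S)" for k
  proof (rule Ck_on_cong)
    show "Ck_on k g (V \<inter> S)"
      using V(3) by (meson Ck_on_subset Int_lower1)
  qed (use V assms(2) in auto)
  then show ?thesis
    using that[of "V \<inter> S"] V assms by auto
qed

lemma smooth_map_on_UNIV:
  assumes "\<And>k. Ck_on k f UNIV"
  shows "smooth_map_on S f"
  unfolding smooth_map_on_def using assms by (intro ballI exI[of _ UNIV] exI[of _ f]) simp

lemma smooth_map_on_bounded_linear_compose:
  assumes "bounded_linear L" "smooth_map_on S f"
  shows "smooth_map_on S (\<lambda>x. L (f x))"
  unfolding smooth_map_on_def
proof
  fix x assume "x \<in> S"
  then obtain U g where "open U" "x \<in> U" "\<forall>k. Ck_on k g U" "\<forall>y\<in>U \<inter> S. g y = f y"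
    using assms(2) unfolding smooth_map_on_def by blast
  then show "\<exists>U g. open U \<and> x \<in> U \<and> (\<forall>k. Ck_on k g U) \<and> (\<forall>y\<in>U \<inter> S. g y = L (f y))"
    by (intro exI[of _ U] exI[of _ "\<lambda>x. L (g x)"]) (auto intro: Ck_on_bounded_linear_compose assms(1))
qed


section \<open>Symmetry of second derivatives\<close>

text \<open>First along \<open>u\<close>, then along \<open>v\<close>.\<close>

abbreviation deriv2 ::
  "('a::real_normed_vector \<Rightarrow> 'b::real_normed_vector) \<Rightarrow> 'a \<Rightarrow> 'a \<Rightarrow> 'a \<Rightarrow> 'b" where
  "deriv2 f x u v \<equiv> frechet_derivative (\<lambda>y. frechet_derivative f (at y) u) (at x) v"

text \<open>Two applications of the mean value theorem, first along \<open>u\<close> to a difference in the direction \<open>v\<close>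
  and then along \<open>v\<close>. The second difference is symmetric in \<open>u\<close> and \<open>v\<close>, which is what makes the
  mixed derivatives agree.\<close>

lemma second_difference_mvt:
  fixes g :: "'a::real_normed_vector \<Rightarrow> real"
  assumes g: "Ck_on (Suc (Suc 0)) g S" and "t > 0"
    and S: "\<And>s r. 0 \<le> s \<Longrightarrow> s \<le> t \<Longrightarrow> 0 \<le> r \<Longrightarrow> r \<le> t \<Longrightarrow> x + s *\<^sub>R u + r *\<^sub>R v \<in> S"
  obtains s r where "0 < s" "s < t" "0 < r" "r < t"
    "g (x + t *\<^sub>R u + t *\<^sub>R v) - g (x + t *\<^sub>R u) - g (x + t *\<^sub>R v) + g x
      = t\<^sup>2 * deriv2 g (x + s *\<^sub>R u + r *\<^sub>R v) u v"
proof -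
  let ?Du = "\<lambda>y. frechet_derivative g (at y) u"
  have D1: "((\<lambda>s. g (x + s *\<^sub>R u + r *\<^sub>R v)) has_real_derivative ?Du (x + s *\<^sub>R u + r *\<^sub>R v)) (at s)"
    if "0 \<le> s" "s \<le> t" "0 \<le> r" "r \<le> t" for s r
  proof -
    note gD = Ck_on_has_derivative[OF g S[OF that]]
    have "((\<lambda>s. x + s *\<^sub>R u + r *\<^sub>R v) has_derivative (\<lambda>h. h *\<^sub>R u)) (at s)"
      by (auto intro!: derivative_eq_intros)
    from has_derivative_compose[OF this gD] show ?thesis
      by (simp add: has_field_derivative_def linear_simps(5)[OF has_derivative_bounded_linear[OF gD]]
          mult_commute_abs)
  qed
  have D2: "((\<lambda>r. ?Du (x + s *\<^sub>R u + r *\<^sub>R v)) has_real_derivative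
      deriv2 g (x + s *\<^sub>R u + r *\<^sub>R v) u v) (at r)"
    if "0 \<le> s" "s \<le> t" "0 \<le> r" "r \<le> t" for s r
  proof -
    have "Ck_on (Suc 0) ?Du S"
      using g by simp
    note gD = Ck_on_has_derivative[OF this S[OF that]]
    have "((\<lambda>r. x + s *\<^sub>R u + r *\<^sub>R v) has_derivative (\<lambda>h. h *\<^sub>R v)) (at r)"
      by (auto intro!: derivative_eq_intros)
    from has_derivative_compose[OF this gD] show ?thesis
      by (simp add: has_field_derivative_def linear_simps(5)[OF has_derivative_bounded_linear[OF gD]]
          mult_commute_abs)
  qed
  have "\<exists>s. 0 < s \<and> s < t \<and>
      (g (x + t *\<^sub>R u + t *\<^sub>R v) - g (x + t *\<^sub>R u + 0 *\<^sub>R v))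
        - (g (x + 0 *\<^sub>R u + t *\<^sub>R v) - g (x + 0 *\<^sub>R u + 0 *\<^sub>R v))
      = (t - 0) * (?Du (x + s *\<^sub>R u + t *\<^sub>R v) - ?Du (x + s *\<^sub>R u + 0 *\<^sub>R v))"
    using \<open>t > 0\<close> by (intro MVT2 DERIV_diff D1) auto
  then obtain s where s: "0 < s" "s < t" and
    1: "g (x + t *\<^sub>R u + t *\<^sub>R v) - g (x + t *\<^sub>R u) - g (x + t *\<^sub>R v) + g x
      = t * (?Du (x + s *\<^sub>R u + t *\<^sub>R v) - ?Du (x + s *\<^sub>R u + 0 *\<^sub>R v))"
    by auto
  have "\<exists>r. 0 < r \<and> r < t \<and> ?Du (x + s *\<^sub>R u + t *\<^sub>R v) - ?Du (x + s *\<^sub>R u + 0 *\<^sub>R v)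
      = (t - 0) * deriv2 g (x + s *\<^sub>R u + r *\<^sub>R v) u v"
    using \<open>t > 0\<close> s by (intro MVT2 D2) auto
  then obtain r where "0 < r" "r < t" "?Du (x + s *\<^sub>R u + t *\<^sub>R v) - ?Du (x + s *\<^sub>R u + 0 *\<^sub>R v)
      = t * deriv2 g (x + s *\<^sub>R u + r *\<^sub>R v) u v"
    by auto
  with 1 s show ?thesis
    by (intro that[of s r]) (simp_all add: power2_eq_square)
qed

text \<open>Both mixed derivatives, taken at suitable points close to \<open>x\<close>, equal the same second difference
  quotient; continuity moves them to \<open>x\<close>.\<close>

lemma deriv2_symmetric_real:
  fixes g :: "'a::real_normed_vector \<Rightarrow> real"
  assumes g: "Ck_on (Suc (Suc 0)) g S" and "open S" "x \<in> S"
  shows "deriv2 g x u v = deriv2 g x v u"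
proof (rule ccontr)
  assume ne: "deriv2 g x u v \<noteq> deriv2 g x v u"
  define e where "e = \<bar>deriv2 g x u v - deriv2 g x v u\<bar> / 2"
  have "e > 0"
    using ne by (simp add: e_def)
  have cont: "continuous_on S (\<lambda>y. deriv2 g y a b)" for a b
    using g by simp
  obtain d0 where d0: "d0 > 0" "ball x d0 \<subseteq> S"
    using assms(2,3) openE by blast
  have lim: "\<exists>d>0. \<forall>y\<in>S. dist y x < d \<longrightarrow> dist (deriv2 g y a b) (deriv2 g x a b) < e" for a b
    using cont[of a b] \<open>x \<in> S\<close> \<open>e > 0\<close> unfolding continuous_on_iff by blast
  obtain d1 where d1: "d1 > 0" "\<And>y. y \<in> S \<Longrightarrow> dist y x < d1 \<Longrightarrow> dist (deriv2 g y u v) (deriv2 g x u v) < e"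
    using lim[of u v] by auto
  obtain d2 where d2: "d2 > 0" "\<And>y. y \<in> S \<Longrightarrow> dist y x < d2 \<Longrightarrow> dist (deriv2 g y v u) (deriv2 g x v u) < e"
    using lim[of v u] by auto
  define d where "d = min d0 (min d1 d2)"
  \<comment> \<open>Half of what the triangle inequality permits, and the summand 1 avoids division by zero.\<close>
  define t where "t = d / (norm u + norm v + 1) / 2"
  have "d > 0"
    using d0 d1 d2 by (simp add: d_def)
  have pos: "norm u + norm v + 1 > 0"
    using norm_ge_zero[of u] norm_ge_zero[of v] by linarith
  then have "t > 0"
    using \<open>d > 0\<close> by (simp add: t_def)
  have small: "norm (s *\<^sub>R u + r *\<^sub>R v) < d" if "0 \<le> s" "s \<le> t" "0 \<le> r" "r \<le> t" for s r
  proof -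
    have "norm (s *\<^sub>R u + r *\<^sub>R v) \<le> s * norm u + r * norm v"
      using norm_triangle_ineq[of "s *\<^sub>R u" "r *\<^sub>R v"] that by simp
    also have "\<dots> \<le> t * norm u + t * norm v"
      using that by (intro add_mono mult_right_mono) auto
    also have "\<dots> \<le> t * (norm u + norm v + 1)"
      using \<open>t > 0\<close> by (simp add: algebra_simps)
    also have "\<dots> = d / 2"
      using pos by (simp add: t_def field_simps)
    also have "\<dots> < d"
      using \<open>d > 0\<close> by simp
    finally show ?thesis .
  qed
  have small': "norm (s *\<^sub>R v + r *\<^sub>R u) < d" if "0 \<le> s" "s \<le> t" "0 \<le> r" "r \<le> t" for s r
    using small[of r s] that by (simp add: add.commute)
  have dist: "dist (x + s *\<^sub>R a + r *\<^sub>R b) x = norm (s *\<^sub>R a + r *\<^sub>R b)" for s r a b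
    by (simp add: dist_norm add.assoc)
  have in_S: "y \<in> S" if "dist y x < d" for y
    using that d0(2) by (auto simp: d_def dist_commute)
  obtain s r where sr: "0 < s" "s < t" "0 < r" "r < t"
    "g (x + t *\<^sub>R u + t *\<^sub>R v) - g (x + t *\<^sub>R u) - g (x + t *\<^sub>R v) + g x
      = t\<^sup>2 * deriv2 g (x + s *\<^sub>R u + r *\<^sub>R v) u v"
    by (rule second_difference_mvt[OF g \<open>t > 0\<close>, of x u v]) (use in_S dist small in auto)
  obtain s' r' where sr': "0 < s'" "s' < t" "0 < r'" "r' < t"
    "g (x + t *\<^sub>R v + t *\<^sub>R u) - g (x + t *\<^sub>R v) - g (x + t *\<^sub>R u) + g x
      = t\<^sup>2 * deriv2 g (x + s' *\<^sub>R v + r' *\<^sub>R u) v u"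
    by (rule second_difference_mvt[OF g \<open>t > 0\<close>, of x v u])
      (use in_S dist small' in auto)
  have eq: "deriv2 g (x + s *\<^sub>R u + r *\<^sub>R v) u v = deriv2 g (x + s' *\<^sub>R v + r' *\<^sub>R u) v u" (is "?a = ?b")
  proof -
    have swap: "x + t *\<^sub>R u + t *\<^sub>R v = x + t *\<^sub>R v + t *\<^sub>R u"
      by (simp add: algebra_simps)
    have "t\<^sup>2 * ?a = t\<^sup>2 * ?b"
      using sr(5) sr'(5) unfolding swap by linarith
    then show ?thesis
      using \<open>t > 0\<close> by simp
  qed
  have n1: "dist (x + s *\<^sub>R u + r *\<^sub>R v) x < d"
    using small[of s r] sr by (simp add: dist)
  have n2: "dist (x + s' *\<^sub>R v + r' *\<^sub>R u) x < d"
    using small'[of s' r'] sr' by (simp add: dist)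
  have a: "dist ?a (deriv2 g x u v) < e"
    using n1 by (intro d1(2) in_S) (auto simp: d_def)
  have b: "dist ?a (deriv2 g x v u) < e"
    unfolding eq using n2 by (intro d2(2) in_S) (auto simp: d_def)
  have "dist (deriv2 g x u v) (deriv2 g x v u)
      \<le> dist (deriv2 g x u v) ?a + dist ?a (deriv2 g x v u)"
    by (rule dist_triangle)
  also have "\<dots> < e + e"
    using a b by (intro add_strict_mono) (simp_all only: dist_commute)
  finally show False
    by (simp add: e_def dist_real_def)
qed

lemma deriv2_symmetric:
  fixes f :: "'a::real_normed_vector \<Rightarrow> 'b::real_inner"
  assumes f: "Ck_on (Suc (Suc 0)) f S" and S: "open S" "x \<in> S"
  shows "deriv2 f x u v = deriv2 f x v u"
proof (rule vector_eq_rdot[THEN iffD1], rule allI)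
  fix b
  have fb: "Ck_on (Suc (Suc 0)) (\<lambda>y. f y \<bullet> b) S"
    by (rule Ck_on_bounded_linear_compose[OF bounded_linear_inner_left S(1) f])
  have D1: "frechet_derivative (\<lambda>y. f y \<bullet> b) (at y) w = frechet_derivative f (at y) w \<bullet> b"
    if "y \<in> S" for y w
    using frechet_derivative_at[OF has_derivative_inner_left[OF Ck_on_has_derivative[OF f that]]]
    by metis
  have "deriv2 (\<lambda>y. f y \<bullet> b) x p q = deriv2 f x p q \<bullet> b" for p q
  proof -
    have "Ck_on (Suc 0) (\<lambda>y. frechet_derivative f (at y) p) S"
      using f by simp
    note has_derivative_inner_left[OF Ck_on_has_derivative[OF this S(2)], of b]
    from has_derivative_transform_within_open[OF this S, of "\<lambda>y. frechet_derivative (\<lambda>y. f y \<bullet> b) (at y) p"]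
    have "((\<lambda>y. frechet_derivative (\<lambda>y. f y \<bullet> b) (at y) p) has_derivative (\<lambda>q. deriv2 f x p q \<bullet> b)) (at x)"
      by (simp add: D1)
    from frechet_derivative_at[OF this] show ?thesis
      by metis
  qed
  with deriv2_symmetric_real[OF fb S] show "deriv2 f x u v \<bullet> b = deriv2 f x v u \<bullet> b"
    by metis
qed


section \<open>The Levi-Civita connection of the sphere\<close>

lemma S6_iff: "x \<in> S6 \<longleftrightarrow> x \<bullet> octone = 0 \<and> x \<bullet> x = 1"
  by (simp add: S6_def ImO_iff norm_eq_1)

lemma tanS6_iff: "v \<in> tanS6 x \<longleftrightarrow> v \<bullet> octone = 0 \<and> v \<bullet> x = 0"
  by (simp add: tanS6_def ImO_iff)

text \<open>For \<open>x\<close> in the sphere this is the orthogonal projection onto \<open>tanS6 x\<close>.\<close>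

definition tan_proj :: "oct \<Rightarrow> oct \<Rightarrow> oct" where
  "tan_proj x w = w - (w \<bullet> octone) *\<^sub>R octone - (w \<bullet> x) *\<^sub>R x"

lemma linear_tan_proj: "linear (tan_proj x)"
  by (rule linearI) (simp_all add: tan_proj_def algebra_simps)

lemma tan_proj_tanS6: "x \<in> S6 \<Longrightarrow> tan_proj x w \<in> tanS6 x"
  by (simp add: tan_proj_def tanS6_iff S6_iff inner_diff_left octone_unit inner_commute[of octone x])

lemma tan_proj_ident: "v \<in> tanS6 x \<Longrightarrow> tan_proj x v = v"
  by (simp add: tan_proj_def tanS6_iff)

lemma tan_proj_sym: "tan_proj x v \<bullet> w = v \<bullet> tan_proj x w"
  by (simp add: tan_proj_def inner_simps inner_commute)

text \<open>Projected constants are the vector fields used to reach every tangent vector of the sphere.\<close>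

lemma tan_proj_vector_field: "(\<lambda>y. tan_proj y w) \<in> vector_fields_S6"
proof -
  let ?c = "w - (w \<bullet> octone) *\<^sub>R octone"
  have "Ck_on k (\<lambda>y. ?c + - (w \<bullet> y) *\<^sub>R y) UNIV" for k
  proof (intro Ck_on_add Ck_on_const)
    have "Ck_on k (\<lambda>y. - (w \<bullet> y)) UNIV"
      by (rule Ck_on_bounded_linear_compose[OF _ _ Ck_on_ident])
        (auto intro: bounded_linear_minus bounded_linear_inner_right)
    then show "Ck_on k (\<lambda>y. - (w \<bullet> y) *\<^sub>R y) UNIV"
      by (intro Ck_on_bilinear[OF bounded_bilinear_scaleR _ _ Ck_on_ident]) auto
  qed auto
  then have "smooth_map_on S6 (\<lambda>y. tan_proj y w)"
    by (intro smooth_map_on_UNIV) (simp add: tan_proj_def)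
  then show ?thesis
    by (simp add: vector_fields_S6_def tan_proj_tanS6)
qed

text \<open>A derivative within the sphere is determined on tangent vectors, because each of them is the
  velocity of a great circle. Hence the derivative of any local extension \<open>g\<close> computes \<open>dS6\<close>.\<close>

lemma dS6_eq:
  assumes x: "x \<in> S6" and v: "v \<in> tanS6 x" and U: "open U" "x \<in> U"
    and g: "(g has_derivative g') (at x)" and fg: "\<And>y. y \<in> U \<Longrightarrow> y \<in> S6 \<Longrightarrow> f y = g y"
  shows "dS6 f x v = g' v"
proof -
  define D where "D = frechet_derivative f (at x within S6)"
  have "(g has_derivative g') (at x within S6)"
    using g by (rule has_derivative_at_withinI)
  moreover have "eventually (\<lambda>y. g y = f y) (at x within S6)"
    unfolding eventually_at_topological using U fg by (intro exI[of _ U]) auto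
  ultimately have fg': "(f has_derivative g') (at x within S6)"
    by (rule has_derivative_transform_eventually) (use fg x U in auto)
  then have fD: "(f has_derivative D) (at x within S6)"
    unfolding D_def by (auto simp: frechet_derivative_works[symmetric] differentiable_def)
  show ?thesis
  proof (cases "v = 0")
    case True
    then show ?thesis
      using linear_0[OF has_derivative_linear[OF g]] linear_0[OF has_derivative_linear[OF fD]]
      by (simp add: dS6_def D_def)
  next
    case False
    define e where "e = v /\<^sub>R norm v"
    have e: "e \<bullet> octone = 0" "e \<bullet> x = 0" "e \<bullet> e = 1"
      using v False by (simp_all add: e_def tanS6_iff dot_square_norm power2_eq_square)
    define c where "c t = cos t *\<^sub>R x + sin t *\<^sub>R e" for t :: real
    have c_S6: "c t \<in> S6" for t
    proof -
      have "c t \<bullet> c t = (cos t)\<^sup>2 + (sin t)\<^sup>2"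
        using x e by (simp add: c_def S6_iff inner_simps inner_commute power2_eq_square)
      then show ?thesis
        using x e by (simp add: S6_iff c_def inner_simps)
    qed
    have "(c has_derivative (\<lambda>h. h *\<^sub>R e)) (at 0 within UNIV)"
      unfolding c_def by (auto intro!: derivative_eq_intros)
    moreover have "c 0 = x"
      by (simp add: c_def)
    ultimately have "((\<lambda>t. f (c t)) has_derivative (\<lambda>h. L (h *\<^sub>R e))) (at 0)"
      if "(f has_derivative L) (at x within S6)" for L
      using has_derivative_in_compose[of c "\<lambda>h. h *\<^sub>R e" 0 UNIV f L]
        has_derivative_subset[OF that, of "range c"] c_S6 by auto
    from has_derivative_unique[OF this[OF fD] this[OF fg']] have "D e = g' e"
      by (auto dest: fun_cong[of _ _ 1])
    moreover have "v = norm v *\<^sub>R e"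
      using False by (simp add: e_def)
    ultimately show ?thesis
      using linear_cmul[OF has_derivative_linear[OF g]] linear_cmul[OF has_derivative_linear[OF fD]]
      by (metis dS6_def D_def)
  qed
qed

lemma vector_field_extension:
  assumes "X \<in> vector_fields_S6" "x \<in> S6"
  obtains U G where "open U" "x \<in> U" "(G has_derivative frechet_derivative G (at x)) (at x)"
      "\<And>y. y \<in> U \<Longrightarrow> y \<in> S6 \<Longrightarrow> X y = G y"
proof -
  obtain U G where "open U" "x \<in> U" "\<forall>k. Ck_on k G U" "\<forall>y\<in>U \<inter> S6. G y = X y"
    using assms unfolding vector_fields_S6_def smooth_map_on_def by blast
  then show ?thesis
    using that[of U G] Ck_on_has_derivative[of 0 G U x] by auto
qed

text \<open>Let \<open>S X Y Z\<close> be the difference between the connection and the flat derivative, paired with \<open>Z\<close>.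
  Metric compatibility of both makes \<open>S\<close> skew in \<open>Y\<close> and \<open>Z\<close>, and vanishing torsion makes it
  symmetric in \<open>X\<close> and \<open>Y\<close>. Alternating the two symmetries around the six permutations gives
  \<open>S = - S\<close>.\<close>

lemma levi_civita_S6_eq_tan_proj:
  assumes LC: "levi_civita_S6 nabla" and X: "X \<in> vector_fields_S6" and Y: "Y \<in> vector_fields_S6"
    and x: "x \<in> S6"
  shows "nabla X Y x = tan_proj x (dS6 Y x (X x))"
proof -
  define S where "S X Y Z = (nabla X Y x - dS6 Y x (X x)) \<bullet> Z x" for X Y Z
  have tan: "Z x \<in> tanS6 x" if "Z \<in> vector_fields_S6" for Z
    using that x by (simp add: vector_fields_S6_def)
  have skew: "S X Y Z = - S X Z Y"
    if VF: "X \<in> vector_fields_S6" "Y \<in> vector_fields_S6" "Z \<in> vector_fields_S6" for X Y Z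
  proof -
    obtain U G where G: "open U" "x \<in> U" "(G has_derivative frechet_derivative G (at x)) (at x)"
        "\<And>y. y \<in> U \<Longrightarrow> y \<in> S6 \<Longrightarrow> Y y = G y"
      using vector_field_extension[OF VF(2) x] by metis
    obtain V H where H: "open V" "x \<in> V" "(H has_derivative frechet_derivative H (at x)) (at x)"
        "\<And>y. y \<in> V \<Longrightarrow> y \<in> S6 \<Longrightarrow> Z y = H y"
      using vector_field_extension[OF VF(3) x] by metis
    have "dS6 (\<lambda>y. Y y \<bullet> Z y) x (X x)
        = G x \<bullet> frechet_derivative H (at x) (X x) + frechet_derivative G (at x) (X x) \<bullet> H x"
      by (rule dS6_eq[OF x tan[OF VF(1)], of "U \<inter> V", OF _ _ has_derivative_inner[OF G(3) H(3)]])
        (use G H in auto)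
    also have "\<dots> = Y x \<bullet> dS6 Z x (X x) + dS6 Y x (X x) \<bullet> Z x"
      using dS6_eq[OF x tan[OF VF(1)] G] dS6_eq[OF x tan[OF VF(1)] H] G(2,4) H(2,4) x by simp
    finally show ?thesis
      using LC VF x unfolding levi_civita_S6_def metric_S6_def
      by (simp add: S_def inner_diff_left inner_diff_right inner_commute)
  qed
  have sym: "S X Y Z = S Y X Z"
    if VF: "X \<in> vector_fields_S6" "Y \<in> vector_fields_S6" "Z \<in> vector_fields_S6" for X Y Z
  proof -
    \<comment> \<open>The torsion condition is tested on linear functions, whose derivatives are known.\<close>
    have "(nabla X Y x - nabla Y X x) \<bullet> w = (dS6 Y x (X x) - dS6 X x (Y x)) \<bullet> w" for w
    proof -
      let ?f = "\<lambda>y. y \<bullet> w"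
      have "?f \<in> smooth_functions_S6"
        unfolding smooth_functions_S6_def
        by (auto intro!: smooth_map_on_UNIV Ck_on_bounded_linear_compose[OF bounded_linear_inner_left _ Ck_on_ident])
      then have "dS6 ?f x (nabla X Y x - nabla Y X x)
          = dS6 (\<lambda>y. dS6 ?f y (Y y)) x (X x) - dS6 (\<lambda>y. dS6 ?f y (X y)) x (Y x)"
        using LC VF x unfolding levi_civita_S6_def torsion_free_S6_def by blast
      moreover have f: "dS6 ?f y v = v \<bullet> w" if "y \<in> S6" "v \<in> tanS6 y" for y v
        by (rule dS6_eq[OF that, of UNIV ?f]) (auto intro!: derivative_eq_intros)
      moreover have "nabla X Y x - nabla Y X x \<in> tanS6 x"
      proof -
        have "nabla X Y \<in> vector_fields_S6" "nabla Y X \<in> vector_fields_S6"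
          using LC VF unfolding levi_civita_S6_def affine_connection_S6_def by blast+
        then show ?thesis
          using tan by (simp add: tanS6_iff inner_diff_left)
      qed
      moreover have "dS6 (\<lambda>y. dS6 ?f y (B y)) x (A x) = dS6 B x (A x) \<bullet> w"
        if AB: "A \<in> vector_fields_S6" "B \<in> vector_fields_S6" for A B
      proof -
        obtain U G where G: "open U" "x \<in> U" "(G has_derivative frechet_derivative G (at x)) (at x)"
            "\<And>y. y \<in> U \<Longrightarrow> y \<in> S6 \<Longrightarrow> B y = G y"
          using vector_field_extension[OF AB(2) x] by metis
        have "dS6 ?f y (B y) = G y \<bullet> w" if y: "y \<in> U" "y \<in> S6" for y
        proof -
          have "B y \<in> tanS6 y"
            using AB(2) y(2) by (simp add: vector_fields_S6_def)
          from f[OF y(2) this] show ?thesis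
            using G(4)[OF y] by simp
        qed
        from dS6_eq[OF x tan[OF AB(1)] G(1,2) has_derivative_inner_left[OF G(3)] this]
        show ?thesis
          using dS6_eq[OF x tan[OF AB(1)] G] by simp
      qed
      ultimately show ?thesis
        using VF x by (simp add: inner_diff_left)
    qed
    from this[of "Z x"] show ?thesis
      by (simp add: S_def inner_diff_left)
  qed
  have S0: "S X Y Z = 0" if VF: "Z \<in> vector_fields_S6" for Z
    using skew[OF X Y VF] skew[OF Y X VF] skew[OF Y VF X] skew[OF VF X Y] skew[OF VF Y X] skew[OF X VF Y]
      sym[OF X Y VF] sym[OF Y VF X] sym[OF X VF Y]
    by linarith
  have "tan_proj x (nabla X Y x - dS6 Y x (X x)) \<bullet> w = 0" for w
    using S0[OF tan_proj_vector_field[of w]] by (simp add: S_def tan_proj_sym)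
  then have "tan_proj x (nabla X Y x - dS6 Y x (X x)) = 0"
    by (metis inner_eq_zero_iff)
  moreover have "nabla X Y x \<in> tanS6 x"
    using LC X Y tan unfolding levi_civita_S6_def affine_connection_S6_def by blast
  ultimately show ?thesis
    by (simp add: linear_diff[OF linear_tan_proj] tan_proj_ident)
qed

text \<open>The covariant derivative of \<open>E\<close> and the derivative of \<open>E\<close> along a map \<open>f\<close> into the sphere
  are expressed by one and the same \<open>G'\<close>, the derivative of a local extension of \<open>E\<close>.\<close>

lemma levi_civita_S6_along:
  assumes LC: "levi_civita_S6 nabla" and E: "E \<in> vector_fields_S6"
    and f: "(f has_derivative f') (at y)" and fS6: "eventually (\<lambda>z. f z \<in> S6) (nhds y)"
  obtains G' where "\<And>X. X \<in> vector_fields_S6 \<Longrightarrow> nabla X E (f y) = tan_proj (f y) (G' (X (f y)))"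
    "((\<lambda>z. E (f z)) has_derivative (\<lambda>u. G' (f' u))) (at y)"
proof -
  have x: "f y \<in> S6"
    using fS6 by (rule eventually_nhds_x_imp_x)
  obtain U G where G: "open U" "f y \<in> U" "(G has_derivative frechet_derivative G (at (f y))) (at (f y))"
      "\<And>z. z \<in> U \<Longrightarrow> z \<in> S6 \<Longrightarrow> E z = G z"
    using vector_field_extension[OF E x] by metis
  have "eventually (\<lambda>z. f z \<in> U) (nhds y)"
    using has_derivative_continuous[OF f] G(1,2)
    by (metis continuous_within tendsto_at_iff_tendsto_nhds topological_tendstoD)
  with fS6 have "eventually (\<lambda>z. G (f z) = E (f z)) (nhds y)"
    by eventually_elim (simp add: G(4))
  then have "eventually (\<lambda>z. G (f z) = E (f z)) (at y)"
    by (simp add: eventually_nhds_conv_at)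
  then have "((\<lambda>z. E (f z)) has_derivative (\<lambda>u. frechet_derivative G (at (f y)) (f' u))) (at y)"
    by (rule has_derivative_transform_eventually[OF has_derivative_compose[OF f G(3)]])
      (use G(2,4) x in auto)
  moreover have "nabla X E (f y) = tan_proj (f y) (frechet_derivative G (at (f y)) (X (f y)))"
    if X: "X \<in> vector_fields_S6" for X
  proof -
    have "X (f y) \<in> tanS6 (f y)"
      using X x by (simp add: vector_fields_S6_def)
    from dS6_eq[OF x this G] show ?thesis
      by (simp add: levi_civita_S6_eq_tan_proj[OF LC X E x])
  qed
  ultimately show ?thesis
    using that by blast
qed


section \<open>Charts\<close>

lemma chart_facts:
  assumes "smooth_manifold T Atl" "c \<in> Atl"
  shows "openin T (fst c)" "inj_on (snd c) (fst c)"
    "homeomorphic_map (subtopology T (fst c)) (top_of_set (snd c ` fst c)) (snd c)"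
    "open (snd c ` fst c)"
proof -
  obtain U h where c: "c = (U, h)"
    by fastforce
  have *: "openin T U \<and> open (h ` U) \<and> homeomorphic_map (subtopology T U) (top_of_set (h ` U)) h"
    using assms c unfolding smooth_manifold_def by blast
  then have "inj_on h (topspace (subtopology T U))"
    using homeomorphic_imp_injective_map by blast
  moreover have "U \<subseteq> topspace T"
    using * openin_subset by blast
  ultimately show "openin T (fst c)" "inj_on (snd c) (fst c)"
    "homeomorphic_map (subtopology T (fst c)) (top_of_set (snd c ` fst c)) (snd c)"
    "open (snd c ` fst c)"
    using * by (simp_all add: c inf_absorb2)
qed

lemma open_chart_image:
  assumes "smooth_manifold T Atl" "c \<in> Atl" "openin T N"
  shows "open (snd c ` (fst c \<inter> N))"
proof -
  note c = chart_facts[OF assms(1,2)]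
  have "openin (subtopology T (fst c)) (fst c \<inter> N)"
    using assms(3) by (metis inf_commute openin_subtopology_Int)
  then have "openin (top_of_set (snd c ` fst c)) (snd c ` (fst c \<inter> N))"
    using homeomorphic_imp_open_map[OF c(3)] by (simp add: open_map_def)
  then show ?thesis
    using c(4) openin_open_eq by blast
qed

lemma in_chart_apply:
  assumes "smooth_manifold T Atl" "c \<in> Atl" "p \<in> fst c"
  shows "in_chart c f (snd c p) = f p"
  using chart_facts(2)[OF assms(1,2)] assms(3) by (simp add: in_chart_def)

lemma smooth_in_chart:
  assumes "smooth_manifold T Atl" "c \<in> Atl" "openin T N" "smooth_on_mfd Atl N f" "p \<in> fst c" "p \<in> N"
  obtains V where "open V" "snd c p \<in> V" "V \<subseteq> snd c ` (fst c \<inter> N)" "\<And>k. Ck_on k (in_chart c f) V"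
proof -
  have "smooth_map_on (snd c ` (fst c \<inter> N)) (in_chart c f)"
    using assms(2,4) unfolding smooth_on_mfd_def by (cases c) auto
  from smooth_map_on_open[OF this open_chart_image[OF assms(1-3)], of "snd c p"] show ?thesis
    using that assms(5,6) by blast
qed

lemma d_chart_has_derivative:
  assumes "smooth_manifold T Atl" "c \<in> Atl" "openin T N" "smooth_on_mfd Atl N f" "p \<in> fst c" "p \<in> N"
  shows "(in_chart c f has_derivative d_chart c f p) (at (snd c p))"
proof -
  obtain V where "snd c p \<in> V" "Ck_on (Suc 0) (in_chart c f) V"
    using smooth_in_chart[OF assms] by metis
  from Ck_on_has_derivative[OF this(2,1)] show ?thesis
    by (simp add: d_chart_def[abs_def])
qed

text \<open>The map \<open>\<tau>\<close> is the derivative of the transition map; the same \<open>\<tau>\<close> serves for all functions, so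
  a tangent vector identified in two charts by its image under one immersion is identified for
  every function.\<close>

lemma d_chart_change:
  assumes M: "smooth_manifold T Atl" and c: "c \<in> Atl" "p \<in> fst c" and c': "c' \<in> Atl" "p \<in> fst c'"
  obtains \<tau> where "\<And>(f :: _ \<Rightarrow> 'b :: real_normed_vector) N u.
    openin T N \<Longrightarrow> p \<in> N \<Longrightarrow> smooth_on_mfd Atl N f \<Longrightarrow> d_chart c f p u = d_chart c' f p (\<tau> u)"
proof -
  let ?tr = "in_chart c (snd c')"
  have o: "open (snd c ` (fst c \<inter> fst c'))"
    by (rule open_chart_image[OF M c(1) chart_facts(1)[OF M c'(1)]])
  have p: "snd c p \<in> snd c ` (fst c \<inter> fst c')"
    using c c' by auto
  have "smooth_map_on (snd c ` (fst c \<inter> fst c')) ?tr"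
    using M c(1) c'(1) unfolding smooth_manifold_def by (cases c; cases c') auto
  from smooth_map_on_open[OF this o p] obtain V where "snd c p \<in> V" "Ck_on (Suc 0) ?tr V"
    by metis
  from Ck_on_has_derivative[OF this(2,1)]
  have tr: "(?tr has_derivative d_chart c (snd c') p) (at (snd c p))"
    by (simp add: d_chart_def[abs_def])
  have "d_chart c f p u = d_chart c' f p (d_chart c (snd c') p u)"
    if N: "openin T N" "p \<in> N" "smooth_on_mfd Atl N f" for f :: "_ \<Rightarrow> 'b" and N u
  proof -
    have "(in_chart c' f has_derivative d_chart c' f p) (at (?tr (snd c p)))"
      using d_chart_has_derivative[OF M c'(1) N(1,3) c'(2) N(2)] by (simp add: in_chart_apply[OF M c])
    from has_derivative_compose[OF tr this]
    have "(in_chart c f has_derivative (\<lambda>u. d_chart c' f p (d_chart c (snd c') p u))) (at (snd c p))"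
      by (rule has_derivative_transform_within_open[OF _ o p])
        (auto simp: in_chart_apply[OF M c(1)] in_chart_apply[OF M c'(1)])
    from has_derivative_unique[OF this d_chart_has_derivative[OF M c(1) N(1,3) c(2) N(2)]]
    show ?thesis
      by metis
  qed
  then show ?thesis
    by (rule that)
qed

text \<open>The product rule for two maps whose inner product is locally constant. It makes
  the derivatives of the immersion and of the unit normal tangent to the sphere.\<close>

lemma inner_constant_has_derivative:
  fixes f g :: "'a::real_normed_vector \<Rightarrow> 'b::real_inner"
  assumes "(f has_derivative f') (at x)" "(g has_derivative g') (at x)"
    and "open V" "x \<in> V" "\<And>y. y \<in> V \<Longrightarrow> f y \<bullet> g y = k"
  shows "f' v \<bullet> g x + f x \<bullet> g' v = 0"
proof -
  have "((\<lambda>y. f y \<bullet> g y) has_derivative (\<lambda>v. f x \<bullet> g' v + f' v \<bullet> g x)) (at x)"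
    by (rule has_derivative_inner[OF assms(1,2)])
  from has_derivative_transform_within_open[OF this assms(3,4), of "\<lambda>y. k"]
  have "((\<lambda>y. k) has_derivative (\<lambda>v. f x \<bullet> g' v + f' v \<bullet> g x)) (at x)"
    using assms(5) by simp
  from has_derivative_unique[OF this has_derivative_const] show ?thesis
    by (metis add.commute)
qed


section \<open>The shape operator in a chart\<close>

locale hypersurface_with_normal =
  fixes T :: "'a topology" and Atl :: "('a, real^5) chart set" and F :: "'a \<Rightarrow> oct"
    and W :: "'a set" and xi :: "'a \<Rightarrow> oct"
  assumes hypersurface: "hypersurface_S6 T Atl F"
    and unit_normal: "unit_normal_on T Atl F W xi"
begin

lemma manifold: "smooth_manifold T Atl"
  using hypersurface by (simp add: hypersurface_S6_def)

lemma open_W: "openin T W"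
  and smooth_xi: "smooth_on_mfd Atl W xi"
  using unit_normal by (simp_all add: unit_normal_on_def)

lemma smooth_F: "smooth_on_mfd Atl (topspace T) F"
  using hypersurface by (simp add: hypersurface_S6_def)

lemma W_subset: "W \<subseteq> topspace T"
  using open_W by (rule openin_subset)

lemma chart_exists:
  assumes "p \<in> W"
  obtains c where "c \<in> Atl" "p \<in> fst c"
proof -
  have "(\<Union>c\<in>Atl. fst c) = topspace T"
    using manifold by (simp add: smooth_manifold_def)
  then show ?thesis
    using that assms W_subset by blast
qed

lemma F_S6: "p \<in> W \<Longrightarrow> F p \<in> S6"
  using hypersurface W_subset by (auto simp: hypersurface_S6_def)

lemma xi_unit:
  assumes "p \<in> W"
  shows "xi p \<bullet> octone = 0" "xi p \<bullet> F p = 0" "xi p \<bullet> xi p = 1"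
  using unit_normal assms by (auto simp: unit_normal_on_def tanS6_iff norm_eq_1)

lemma xi_perp: "p \<in> W \<Longrightarrow> v \<in> tanM Atl F p \<Longrightarrow> xi p \<bullet> v = 0"
  using unit_normal by (auto simp: unit_normal_on_def)

lemma F_has_derivative:
  assumes "c \<in> Atl" "p \<in> fst c" "p \<in> W"
  shows "(in_chart c F has_derivative d_chart c F p) (at (snd c p))"
  by (rule d_chart_has_derivative[OF manifold assms(1) openin_topspace smooth_F assms(2)])
    (use assms W_subset in auto)

lemma xi_has_derivative:
  assumes "c \<in> Atl" "p \<in> fst c" "p \<in> W"
  shows "(in_chart c xi has_derivative d_chart c xi p) (at (snd c p))"
  by (rule d_chart_has_derivative[OF manifold assms(1) open_W smooth_xi assms(2,3)])

lemma in_chart_nhd: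
  assumes "c \<in> Atl" "p \<in> fst c" "p \<in> W" "\<And>q. q \<in> fst c \<Longrightarrow> q \<in> W \<Longrightarrow> P (F q) (xi q)"
  obtains V where "open V" "snd c p \<in> V"
    "\<And>y. y \<in> V \<Longrightarrow> P (in_chart c F y) (in_chart c xi y)"
proof
  show "open (snd c ` (fst c \<inter> W))"
    by (rule open_chart_image[OF manifold assms(1) open_W])
  show "snd c p \<in> snd c ` (fst c \<inter> W)"
    using assms by auto
  fix y assume "y \<in> snd c ` (fst c \<inter> W)"
  then show "P (in_chart c F y) (in_chart c xi y)"
    using assms(4) by (auto simp: in_chart_apply[OF manifold assms(1)])
qed

lemma dF_tangent:
  assumes c: "c \<in> Atl" "p \<in> fst c" "p \<in> W"
  shows "d_chart c F p u \<bullet> octone = 0" "d_chart c F p u \<bullet> F p = 0" "xi p \<bullet> d_chart c F p u = 0"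
proof -
  obtain V where V: "open V" "snd c p \<in> V"
    "\<And>y. y \<in> V \<Longrightarrow> in_chart c F y \<bullet> octone = 0 \<and> in_chart c F y \<bullet> in_chart c F y = 1"
    by (rule in_chart_nhd[OF c, of "\<lambda>x n. x \<bullet> octone = 0 \<and> x \<bullet> x = 1"])
      (use F_S6 in \<open>auto simp: S6_iff\<close>)
  note D = F_has_derivative[OF c]
  show "d_chart c F p u \<bullet> octone = 0"
    using inner_constant_has_derivative[OF D has_derivative_const V(1,2), of octone 0 u] V(3) by simp
  show "d_chart c F p u \<bullet> F p = 0"
    using inner_constant_has_derivative[OF D D V(1,2), of 1 u] V(3)
    by (simp add: in_chart_apply[OF manifold c(1,2)] inner_commute)
  show "xi p \<bullet> d_chart c F p u = 0"
  proof (rule xi_perp[OF c(3)])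
    show "d_chart c F p u \<in> tanM Atl F p"
      unfolding tanM_def using c by blast
  qed
qed

lemma dxi_tangent:
  assumes c: "c \<in> Atl" "p \<in> fst c" "p \<in> W"
  shows "d_chart c xi p u \<bullet> octone = 0" "d_chart c xi p u \<bullet> F p = 0" "d_chart c xi p u \<bullet> xi p = 0"
proof -
  obtain V where V: "open V" "snd c p \<in> V"
    "\<And>y. y \<in> V \<Longrightarrow> in_chart c xi y \<bullet> octone = 0 \<and> in_chart c xi y \<bullet> in_chart c F y = 0
      \<and> in_chart c xi y \<bullet> in_chart c xi y = 1"
    by (rule in_chart_nhd[OF c, of "\<lambda>x n. n \<bullet> octone = 0 \<and> n \<bullet> x = 0 \<and> n \<bullet> n = 1"])
      (use xi_unit in auto)
  note D = xi_has_derivative[OF c]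
  note ap = in_chart_apply[OF manifold c(1,2)]
  show "d_chart c xi p u \<bullet> octone = 0"
    using inner_constant_has_derivative[OF D has_derivative_const V(1,2), of octone 0 u] V(3) by simp
  show "d_chart c xi p u \<bullet> F p = 0"
    using inner_constant_has_derivative[OF D F_has_derivative[OF c] V(1,2), of 0 u] V(3) dF_tangent[OF c]
    by (simp add: ap)
  show "d_chart c xi p u \<bullet> xi p = 0"
    using inner_constant_has_derivative[OF D D V(1,2), of 1 u] V(3)
    by (simp add: ap inner_commute)
qed

text \<open>The inclusion from left to right is \<open>dF_tangent\<close>; equality holds because both sides have
  dimension 5, the right-hand side being the orthogonal complement of the three orthogonal vectors
  \<open>octone\<close>, \<open>F p\<close> and \<open>xi p\<close> in dimension 8.\<close>

lemma range_dF:
  assumes c: "c \<in> Atl" "p \<in> fst c" "p \<in> W"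
  shows "range (d_chart c F p) = {v \<in> ImO. v \<bullet> F p = 0 \<and> v \<bullet> xi p = 0}"
proof (rule subspace_dim_equal)
  have lin: "linear (d_chart c F p)"
    by (rule has_derivative_linear[OF F_has_derivative[OF c]])
  show "subspace (range (d_chart c F p))"
    using lin by (intro linear_subspace_image subspace_UNIV)
  show "subspace {v \<in> ImO. v \<bullet> F p = 0 \<and> v \<bullet> xi p = 0}"
    by (auto simp: subspace_def ImO_iff inner_simps)
  show "range (d_chart c F p) \<subseteq> {v \<in> ImO. v \<bullet> F p = 0 \<and> v \<bullet> xi p = 0}"
    using dF_tangent[OF c] by (auto simp: ImO_iff inner_commute)
  let ?A = "{octone, F p, xi p}"
  have perp: "octone \<bullet> F p = 0" "octone \<bullet> xi p = 0" "F p \<bullet> xi p = 0" "F p \<bullet> octone = 0" "xi p \<bullet> octone = 0"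
     "xi p \<bullet> F p = 0"
    using F_S6[OF c(3)] xi_unit[OF c(3)] by (simp_all add: S6_iff inner_commute)
  have nz: "octone \<noteq> 0" "F p \<noteq> 0" "xi p \<noteq> 0"
    using octone_unit F_S6[OF c(3)] xi_unit[OF c(3)] by (auto simp: S6_iff)
  have "pairwise orthogonal ?A"
    using perp by (auto simp: pairwise_def orthogonal_def)
  then have "independent ?A"
    using nz by (intro pairwise_orthogonal_independent) auto
  moreover have "card ?A = 3"
    using perp nz by (auto simp: card_insert_if)
  ultimately have "dim (span ?A) = 3"
    by (simp add: dim_eq_card_independent)
  moreover have "dim {y \<in> UNIV. \<forall>x \<in> span ?A. orthogonal x y} + dim (span ?A) = dim (UNIV :: oct set)"
    by (rule dim_subspace_orthogonal_to_vectors) auto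
  moreover have "{y \<in> UNIV. \<forall>x \<in> span ?A. orthogonal x y} = {v \<in> ImO. v \<bullet> F p = 0 \<and> v \<bullet> xi p = 0}"
  proof (intro set_eqI iffI)
    fix y assume "y \<in> {v \<in> ImO. v \<bullet> F p = 0 \<and> v \<bullet> xi p = 0}"
    then have "\<And>x. x \<in> ?A \<Longrightarrow> orthogonal y x"
      by (auto simp: orthogonal_def ImO_iff)
    then show "y \<in> {y \<in> UNIV. \<forall>x \<in> span ?A. orthogonal x y}"
      using orthogonal_to_span[of _ ?A y] orthogonal_commute by blast
  qed (auto simp: orthogonal_def ImO_iff inner_commute span_base)
  ultimately have "dim {v \<in> ImO. v \<bullet> F p = 0 \<and> v \<bullet> xi p = 0} = 5"
    by simp
  moreover have "dim (range (d_chart c F p)) = dim (UNIV :: (real^5) set)"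
    using lin hypersurface c(1,2) by (intro dim_image_eq) (auto simp: hypersurface_S6_def)
  ultimately show "dim {v \<in> ImO. v \<bullet> F p = 0 \<and> v \<bullet> xi p = 0} \<le> dim (range (d_chart c F p))"
    by simp
qed

lemma tanM_eq:
  assumes "p \<in> W"
  shows "tanM Atl F p = {v \<in> ImO. v \<bullet> F p = 0 \<and> v \<bullet> xi p = 0}"
proof -
  obtain c where c: "c \<in> Atl" "p \<in> fst c"
    using chart_exists[OF assms] .
  have "tanM Atl F p = (\<Union>c\<in>{c \<in> Atl. p \<in> fst c}. range (d_chart c F p))"
    unfolding tanM_def by blast
  also have "\<dots> = {v \<in> ImO. v \<bullet> F p = 0 \<and> v \<bullet> xi p = 0}"
    using c range_dF[OF _ _ assms] by (intro SUP_eq_const) blast+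
  finally show ?thesis .
qed

lemma phi_eq:
  assumes p: "p \<in> W" and v: "v \<in> tanM Atl F p"
  shows "phi Atl F xi p v = ocross (F p) v - (ocross (F p) v \<bullet> xi p) *\<^sub>R xi p"
  unfolding phi_def
proof (rule the_equality)
  have "ocross (F p) v \<bullet> octone = 0"
    using ocross_in_ImO by (simp add: ImO_iff)
  moreover have "ocross (F p) v \<bullet> F p = 0"
    by (rule ocross_orthogonal)
  ultimately show "ocross (F p) v - (ocross (F p) v \<bullet> xi p) *\<^sub>R xi p \<in> tanM Atl F p \<and>
     (\<exists>f. J (F p) v = ocross (F p) v - (ocross (F p) v \<bullet> xi p) *\<^sub>R xi p + f *\<^sub>R xi p)"
    using xi_unit[OF p]
    by (auto simp: tanM_eq[OF p] ImO_iff inner_diff_left J_def intro!: exI[of _ "ocross (F p) v \<bullet> xi p"])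
  fix w assume "w \<in> tanM Atl F p \<and> (\<exists>f. J (F p) v = w + f *\<^sub>R xi p)"
  then obtain f where w: "w \<bullet> xi p = 0" "ocross (F p) v = w + f *\<^sub>R xi p"
    by (auto simp: tanM_eq[OF p] J_def)
  then have "ocross (F p) v \<bullet> xi p = f"
    using xi_unit[OF p] by (simp add: inner_add_left)
  with w show "w = ocross (F p) v - (ocross (F p) v \<bullet> xi p) *\<^sub>R xi p"
    by simp
qed

text \<open>For any admissible representation \<open>xi = (\<Sum>i<n. a\<^sub>i (E\<^sub>i \<circ> F))\<close> the product rule computes the flat
  derivative of \<open>xi\<close>, and its projection to the sphere is the right-hand side of the definition of
  the covariant derivative. The projection does nothing, as the flat derivative is already
  tangent. The representation may live in another chart, so the direction \<open>u\<close> is first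
  transported to it; the injectivity of \<open>dF\<close> shows that it becomes the given \<open>u'\<close>.\<close>

lemma is_cov_along_unique:
  assumes LC: "levi_civita_S6 nabla" and c: "c \<in> Atl" "p \<in> fst c" "p \<in> W"
    and w: "is_cov_along nabla T Atl F xi p (d_chart c F p u) w"
  shows "w = d_chart c xi p u"
proof -
  obtain N c' u' X and n :: nat and a :: "nat \<Rightarrow> 'a \<Rightarrow> real" and E where
    N: "openin T N" "p \<in> N" and c': "c' \<in> Atl" "p \<in> fst c'"
    and u': "d_chart c' F p u' = d_chart c F p u"
    and X: "X \<in> vector_fields_S6" "X (F p) = d_chart c F p u"
    and aE: "\<forall>i<n. smooth_on_mfd Atl N (a i) \<and> E i \<in> vector_fields_S6"
    and xi: "\<forall>q\<in>N. xi q = (\<Sum>i<n. a i q *\<^sub>R E i (F q))"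
    and w_eq: "w = (\<Sum>i<n. d_chart c' (a i) p u' *\<^sub>R E i (F p) + a i p *\<^sub>R nabla X (E i) (F p))"
    using w unfolding is_cov_along_def by (elim exE conjE) (rule that; assumption)
  note ap = in_chart_apply[OF manifold c'(1)]
  have pT: "p \<in> topspace T"
    using W_subset c(3) by auto
  obtain \<tau> where \<tau>: "\<And>(f :: _ \<Rightarrow> oct) N u. openin T N \<Longrightarrow> p \<in> N \<Longrightarrow> smooth_on_mfd Atl N f
      \<Longrightarrow> d_chart c f p u = d_chart c' f p (\<tau> u)"
    using d_chart_change[OF manifold c(1,2) c'] by metis
  have "d_chart c' F p u' = d_chart c' F p (\<tau> u)"
    using u' \<tau>[OF openin_topspace pT smooth_F] by simp
  moreover have "inj (d_chart c' F p)"
    using hypersurface c' by (auto simp: hypersurface_S6_def)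
  ultimately have "u' = \<tau> u"
    by (simp add: inj_eq)
  then have xi_u: "d_chart c xi p u = d_chart c' xi p u'"
    using \<tau>[OF open_W c(3) smooth_xi] by simp
  let ?y = "snd c' p"
  note DF = F_has_derivative[OF c' c(3)]
  have o: "open (snd c' ` (fst c' \<inter> (N \<inter> W)))" "?y \<in> snd c' ` (fst c' \<inter> (N \<inter> W))"
    using open_chart_image[OF manifold c'(1) openin_Int[OF N(1) open_W]] N c c' by auto
  have "eventually (\<lambda>z. in_chart c' F z \<in> S6) (nhds ?y)"
    unfolding eventually_nhds using o F_S6
    by (intro exI[of _ "snd c' ` (fst c' \<inter> (N \<inter> W))"]) (auto simp: ap)
  then have "\<exists>G'. nabla X (E i) (F p) = tan_proj (F p) (G' (X (F p))) \<and>
      ((\<lambda>z. E i (in_chart c' F z)) has_derivative (\<lambda>u. G' (d_chart c' F p u))) (at ?y)" if "i < n" for i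
    using levi_civita_S6_along[OF LC _ DF, of "E i"] aE that X(1) ap[OF c'(2), of F] by metis
  then obtain G where G: "\<And>i. i < n \<Longrightarrow> nabla X (E i) (F p) = tan_proj (F p) (G i (X (F p)))"
      "\<And>i. i < n \<Longrightarrow> ((\<lambda>z. E i (in_chart c' F z)) has_derivative (\<lambda>u. G i (d_chart c' F p u))) (at ?y)"
    by metis
  have "((\<lambda>z. \<Sum>i<n. in_chart c' (a i) z *\<^sub>R E i (in_chart c' F z)) has_derivative
      (\<lambda>u. \<Sum>i<n. in_chart c' (a i) ?y *\<^sub>R G i (d_chart c' F p u)
        + d_chart c' (a i) p u *\<^sub>R E i (in_chart c' F ?y))) (at ?y)"
    by (intro has_derivative_sum has_derivative_scaleR d_chart_has_derivative[OF manifold c'(1) N(1) _ c'(2) N(2)] G(2))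
      (use aE in auto)
  from has_derivative_transform_within_open[OF this o, of "in_chart c' xi"]
  have "(in_chart c' xi has_derivative
      (\<lambda>u. \<Sum>i<n. in_chart c' (a i) ?y *\<^sub>R G i (d_chart c' F p u)
        + d_chart c' (a i) p u *\<^sub>R E i (in_chart c' F ?y))) (at ?y)"
    using xi by (force simp: ap)
  from has_derivative_unique[OF xi_has_derivative[OF c' c(3)] this]
  have D: "d_chart c' xi p u' = (\<Sum>i<n. a i p *\<^sub>R G i (X (F p)) + d_chart c' (a i) p u' *\<^sub>R E i (F p))"
    using u' X(2) by (simp add: ap[OF c'(2)] fun_eq_iff)
  have tan: "d_chart c' xi p u' \<in> tanS6 (F p)"
    using dxi_tangent[OF c' c(3)] by (simp add: tanS6_iff)
  have tanE: "tan_proj (F p) (E i (F p)) = E i (F p)" if "i < n" for i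
    using aE that F_S6[OF c(3)] by (intro tan_proj_ident) (auto simp: vector_fields_S6_def)
  have "d_chart c' xi p u' = tan_proj (F p) (d_chart c' xi p u')"
    using tan_proj_ident[OF tan] by simp
  also have "\<dots> = (\<Sum>i<n. a i p *\<^sub>R tan_proj (F p) (G i (X (F p)))
      + d_chart c' (a i) p u' *\<^sub>R tan_proj (F p) (E i (F p)))"
    unfolding D by (simp add: linear_sum[OF linear_tan_proj] linear_add[OF linear_tan_proj]
        linear_cmul[OF linear_tan_proj])
  also have "\<dots> = w"
    unfolding w_eq by (intro sum.cong) (simp_all add: G(1) tanE)
  finally show ?thesis
    by (simp add: xi_u)
qed

text \<open>Expanding \<open>xi\<close> in the standard basis and projecting to the sphere gives a representation by projected
  constant fields.\<close>

lemma is_cov_along_exists: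
  assumes LC: "levi_civita_S6 nabla" and c: "c \<in> Atl" "p \<in> fst c" "p \<in> W"
  shows "\<exists>w. is_cov_along nabla T Atl F xi p (d_chart c F p u) w"
proof -
  obtain b where b: "bij_betw b {..<DIM(oct)} (Basis :: oct set)"
    using ex_bij_betw_nat_finite[of "Basis :: oct set"] by (auto simp: atLeast0LessThan)
  define a where "a i q = xi q \<bullet> b i" for i q
  have sm: "smooth_on_mfd Atl W (a i)" for i
    unfolding smooth_on_mfd_def
  proof safe
    fix U h assume "(U, h) \<in> Atl"
    then have "smooth_map_on (h ` (U \<inter> W)) (in_chart (U, h) xi)"
      using smooth_xi by (auto simp: smooth_on_mfd_def)
    from smooth_map_on_bounded_linear_compose[OF bounded_linear_inner_left this, of "b i"]
    show "smooth_map_on (h ` (U \<inter> W)) (in_chart (U, h) (a i))"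
      by (simp add: in_chart_def a_def comp_def)
  qed
  have xi: "xi q = (\<Sum>i<DIM(oct). a i q *\<^sub>R tan_proj (F q) (b i))" if q: "q \<in> W" for q
  proof -
    have "(\<Sum>i<DIM(oct). a i q *\<^sub>R b i) = (\<Sum>e\<in>Basis. (xi q \<bullet> e) *\<^sub>R e)"
      unfolding a_def by (rule sum.reindex_bij_betw[OF b])
    also have "\<dots> = xi q"
      by (rule euclidean_representation)
    finally have "tan_proj (F q) (\<Sum>i<DIM(oct). a i q *\<^sub>R b i) = tan_proj (F q) (xi q)"
      by (rule arg_cong)
    also have "\<dots> = xi q"
      using xi_unit[OF q] by (intro tan_proj_ident) (simp add: tanS6_iff)
    finally show ?thesis
      by (simp add: linear_sum[OF linear_tan_proj] linear_cmul[OF linear_tan_proj])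
  qed
  have "tan_proj (F p) (d_chart c F p u) = d_chart c F p u"
    using dF_tangent[OF c] by (intro tan_proj_ident) (simp add: tanS6_iff)
  then show ?thesis
    unfolding is_cov_along_def
    using open_W c sm xi tan_proj_vector_field
    by (intro exI[of _ "\<Sum>i<DIM(oct). d_chart c (a i) p u *\<^sub>R tan_proj (F p) (b i)
          + a i p *\<^sub>R nabla (\<lambda>y. tan_proj y (d_chart c F p u)) (\<lambda>y. tan_proj y (b i)) (F p)"]
        exI[of _ W] exI[of _ c] exI[of _ u] exI[of _ "\<lambda>y. tan_proj y (d_chart c F p u)"]
        exI[of _ "DIM(oct)"] exI[of _ a] exI[of _ "\<lambda>i y. tan_proj y (b i)"]) auto
qed

lemma shape_op_eq:
  assumes "levi_civita_S6 nabla" "c \<in> Atl" "p \<in> fst c" "p \<in> W"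
  shows "shape_op nabla T Atl F xi p (d_chart c F p u) = - d_chart c xi p u"
proof -
  obtain w where w: "is_cov_along nabla T Atl F xi p (d_chart c F p u) w"
    using is_cov_along_exists[OF assms] by blast
  with is_cov_along_unique[OF assms] have "cov_along nabla T Atl F xi p (d_chart c F p u) = d_chart c xi p u"
    unfolding cov_along_def by (metis the_equality)
  then show ?thesis
    by (simp add: shape_op_def)
qed

end


section \<open>The exterior derivative of the Hopf condition\<close>

text \<open>Consider the one-forms \<open>\<theta> = \<langle>dn, g\<rangle>\<close> and \<open>\<eta> = \<langle>df, g\<rangle>\<close>. If \<open>\<theta> = c \<eta>\<close>, then \<open>d\<theta> = c d\<eta>\<close> on the
  kernel of \<open>\<eta>\<close>. The proportionality is stated without the factor \<open>c\<close>, as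
  \<open>\<theta>(u) \<eta>(w) = \<theta>(w) \<eta>(u)\<close>, because then no differentiability of \<open>c\<close> has to be established; at \<open>x\<close>
  the factor is recovered as \<open>\<theta>(w)\<close> from \<open>\<eta>(w) = 1\<close>. Second derivatives cancel by symmetry.\<close>

lemma deriv_of_proportional_forms:
  fixes f n g :: "'a::real_normed_vector \<Rightarrow> 'b::real_inner"
  assumes V: "open V" "x \<in> V"
    and f: "Ck_on (Suc (Suc 0)) f V" and n: "Ck_on (Suc (Suc 0)) n V"
    and g: "(g has_derivative g') (at x)"
    and proportional: "\<And>y u w. y \<in> V \<Longrightarrow>
      (frechet_derivative n (at y) u \<bullet> g y) * (frechet_derivative f (at y) w \<bullet> g y)
        = (frechet_derivative n (at y) w \<bullet> g y) * (frechet_derivative f (at y) u \<bullet> g y)"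
    and u: "frechet_derivative f (at x) u \<bullet> g x = 0"
    and v: "frechet_derivative f (at x) v \<bullet> g x = 0"
    and w: "frechet_derivative f (at x) w \<bullet> g x = 1"
  shows "frechet_derivative n (at x) u \<bullet> g' v - frechet_derivative n (at x) v \<bullet> g' u
    = (frechet_derivative n (at x) w \<bullet> g x)
      * (frechet_derivative f (at x) u \<bullet> g' v - frechet_derivative f (at x) v \<bullet> g' u)"
proof -
  have form: "((\<lambda>y. frechet_derivative k (at y) a \<bullet> g y) has_derivative
      (\<lambda>b. frechet_derivative k (at x) a \<bullet> g' b + deriv2 k x a b \<bullet> g x)) (at x)"
    if "Ck_on (Suc (Suc 0)) k V" for k :: "'a \<Rightarrow> 'b" and a
  proof -
    have "Ck_on (Suc 0) (\<lambda>y. frechet_derivative k (at y) a) V"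
      using that by simp
    from has_derivative_inner[OF Ck_on_has_derivative[OF this V(2)] g] show ?thesis .
  qed
  have along: "frechet_derivative n (at x) a \<bullet> g' b + deriv2 n x a b \<bullet> g x
      = (frechet_derivative n (at x) w \<bullet> g x) * (frechet_derivative f (at x) a \<bullet> g' b + deriv2 f x a b \<bullet> g x)"
    if a: "frechet_derivative f (at x) a \<bullet> g x = 0" for a b
  proof -
    have na: "frechet_derivative n (at x) a \<bullet> g x = 0"
      using proportional[OF V(2), of a w] a w by simp
    have "((\<lambda>y. (frechet_derivative n (at y) a \<bullet> g y) * (frechet_derivative f (at y) w \<bullet> g y)
        - (frechet_derivative n (at y) w \<bullet> g y) * (frechet_derivative f (at y) a \<bullet> g y)) has_derivative
      (\<lambda>b. ((frechet_derivative n (at x) a \<bullet> g x) * (frechet_derivative f (at x) w \<bullet> g' b + deriv2 f x w b \<bullet> g x)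
          + (frechet_derivative n (at x) a \<bullet> g' b + deriv2 n x a b \<bullet> g x) * (frechet_derivative f (at x) w \<bullet> g x))
        - ((frechet_derivative n (at x) w \<bullet> g x) * (frechet_derivative f (at x) a \<bullet> g' b + deriv2 f x a b \<bullet> g x)
          + (frechet_derivative n (at x) w \<bullet> g' b + deriv2 n x w b \<bullet> g x) * (frechet_derivative f (at x) a \<bullet> g x)))) (at x)"
      by (intro has_derivative_diff has_derivative_mult form f n)
    from has_derivative_transform_within_open[OF this V, of "\<lambda>y. 0"]
    have "((\<lambda>y. 0) has_derivative (\<lambda>b. (frechet_derivative n (at x) a \<bullet> g' b + deriv2 n x a b \<bullet> g x)
        - (frechet_derivative n (at x) w \<bullet> g x) * (frechet_derivative f (at x) a \<bullet> g' b + deriv2 f x a b \<bullet> g x))) (at x)"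
      using proportional by (simp add: a na w)
    from has_derivative_unique[OF this has_derivative_const] show ?thesis
      by (simp add: fun_eq_iff)
  qed
  show ?thesis
    using along[OF u, of v] along[OF v, of u] deriv2_symmetric[OF f V, of u v] deriv2_symmetric[OF n V, of u v]
    by (simp add: right_diff_distrib distrib_left)
qed


section \<open>Hypersurfaces with anticommuting shape operator\<close>

context hypersurface_with_normal
begin

lemma tanM_chartE:
  assumes "c \<in> Atl" "p \<in> fst c" "p \<in> W" "v \<in> tanM Atl F p"
  obtains u where "v = d_chart c F p u"
  using assms(4) range_dF[OF assms(1-3)] tanM_eq[OF assms(3)] by blast

lemma shape_op_tangent:
  assumes LC: "levi_civita_S6 nabla" and p: "p \<in> W" and v: "v \<in> tanM Atl F p"
  shows "shape_op nabla T Atl F xi p v \<in> tanM Atl F p"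
proof -
  obtain c where c: "c \<in> Atl" "p \<in> fst c"
    using chart_exists[OF p] .
  obtain u where "v = d_chart c F p u"
    by (rule tanM_chartE[OF c p v])
  then show ?thesis
    using dxi_tangent[OF c p] shape_op_eq[OF LC c p] by (simp add: tanM_eq[OF p] ImO_iff)
qed

text \<open>Differentiating \<open>\<langle>xi, dF e\<rangle> = 0\<close> along \<open>d\<close> identifies the second fundamental form with the normal
  component of the second derivative of \<open>F\<close>, which is symmetric.\<close>

lemma shape_op_symmetric:
  assumes LC: "levi_civita_S6 nabla" and p: "p \<in> W"
    and v: "v \<in> tanM Atl F p" and w: "w \<in> tanM Atl F p"
  shows "shape_op nabla T Atl F xi p v \<bullet> w = v \<bullet> shape_op nabla T Atl F xi p w"
proof -
  obtain c where c: "c \<in> Atl" "p \<in> fst c"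
    using chart_exists[OF p] .
  obtain a b where ab: "v = d_chart c F p a" "w = d_chart c F p b"
    using tanM_chartE[OF c p v] tanM_chartE[OF c p w] by metis
  obtain V where V: "open V" "snd c p \<in> V" "V \<subseteq> snd c ` (fst c \<inter> topspace T)"
      "\<And>k. Ck_on k (in_chart c F) V"
    using smooth_in_chart[OF manifold c(1) openin_topspace smooth_F c(2), OF subsetD[OF W_subset p]] by metis
  define V' where "V' = V \<inter> snd c ` (fst c \<inter> W)"
  have V': "open V'" "snd c p \<in> V'"
    using V open_chart_image[OF manifold c(1) open_W] c p by (auto simp: V'_def)
  have perp: "in_chart c xi y \<bullet> frechet_derivative (in_chart c F) (at y) e = 0" if "y \<in> V'" for y e
  proof -
    obtain q where q: "q \<in> fst c" "q \<in> W" "y = snd c q"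
      using \<open>y \<in> V'\<close> by (auto simp: V'_def)
    then show ?thesis
      using dF_tangent(3)[OF c(1) q(1,2)] by (simp add: in_chart_apply[OF manifold c(1) q(1)] d_chart_def)
  qed
  have F2: "Ck_on (Suc (Suc 0)) (in_chart c F) V"
    by (rule V(4))
  have "d_chart c xi p d \<bullet> d_chart c F p e = - (xi p \<bullet> deriv2 (in_chart c F) (snd c p) e d)" for d e
  proof -
    have "Ck_on (Suc 0) (\<lambda>y. frechet_derivative (in_chart c F) (at y) e) V"
      using F2 by simp
    note D = Ck_on_has_derivative[OF this V(2)]
    from inner_constant_has_derivative[OF xi_has_derivative[OF c p] D V' perp, of d] show ?thesis
      by (simp add: in_chart_apply[OF manifold c] d_chart_def)
  qed
  then show ?thesis
    using deriv2_symmetric[OF F2 V(1,2), of a b]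
    by (simp add: ab shape_op_eq[OF LC c p] inner_commute[of _ "d_chart c xi p b"])
qed

lemma shape_op_zero:
  assumes LC: "levi_civita_S6 nabla" and p: "p \<in> W"
  shows "shape_op nabla T Atl F xi p 0 = 0"
proof -
  obtain c where c: "c \<in> Atl" "p \<in> fst c"
    using chart_exists[OF p] .
  show ?thesis
    using shape_op_eq[OF LC c p, of 0] linear_0[OF has_derivative_linear[OF F_has_derivative[OF c p]]]
      linear_0[OF has_derivative_linear[OF xi_has_derivative[OF c p]]] by simp
qed

lemma J_xi:
  assumes p: "p \<in> W"
  shows "ocross (F p) (xi p) \<in> tanM Atl F p"
    "ocross (F p) (ocross (F p) (xi p)) = - xi p"
    "ocross (F p) (xi p) \<bullet> ocross (F p) (xi p) = 1"
    "phi Atl F xi p (ocross (F p) (xi p)) = 0"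
proof -
  have ImO: "F p \<in> ImO" "xi p \<in> ImO"
    using F_S6[OF p] xi_unit[OF p] by (simp_all add: ImO_iff S6_iff)
  show tan: "ocross (F p) (xi p) \<in> tanM Atl F p"
    by (simp add: tanM_eq[OF p] ocross_in_ImO ocross_orthogonal)
  show twice: "ocross (F p) (ocross (F p) (xi p)) = - xi p"
    using ocross_twice[OF ImO] F_S6[OF p] xi_unit[OF p] by (simp add: S6_iff inner_commute)
  show "ocross (F p) (xi p) \<bullet> ocross (F p) (xi p) = 1"
    using inner_ocross_ocross[OF ImO] F_S6[OF p] xi_unit[OF p] by (simp add: S6_iff inner_commute)
  show "phi Atl F xi p (ocross (F p) (xi p)) = 0"
    using phi_eq[OF p tan] xi_unit[OF p] by (simp add: twice)
qed

text \<open>With \<open>U = J \<xi>\<close> the condition reads \<open>\<phi> (A U) = 0\<close>, so \<open>J (A U)\<close> is a multiple of the normal; applying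
  \<open>J\<close> once more makes \<open>A U\<close> a multiple of \<open>U\<close>.\<close>

lemma anticommuting_imp_hopf:
  assumes LC: "levi_civita_S6 nabla" and p: "p \<in> W"
    and anti: "\<And>v. v \<in> tanM Atl F p \<Longrightarrow> shape_op nabla T Atl F xi p (phi Atl F xi p v)
          + phi Atl F xi p (shape_op nabla T Atl F xi p v) = 0"
  obtains \<alpha> where "shape_op nabla T Atl F xi p (ocross (F p) (xi p)) = \<alpha> *\<^sub>R ocross (F p) (xi p)"
proof -
  let ?A = "shape_op nabla T Atl F xi p" and ?U = "ocross (F p) (xi p)"
  note U = J_xi[OF p]
  have AU: "?A ?U \<in> tanM Atl F p"
    by (rule shape_op_tangent[OF LC p U(1)])
  have "phi Atl F xi p (?A ?U) = 0"
    using anti[OF U(1)] shape_op_zero[OF LC p] U(4) by simp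
  then have "ocross (F p) (?A ?U) = (ocross (F p) (?A ?U) \<bullet> xi p) *\<^sub>R xi p"
    using phi_eq[OF p AU] by simp
  then have "ocross (F p) (ocross (F p) (?A ?U)) = (ocross (F p) (?A ?U) \<bullet> xi p) *\<^sub>R ?U"
    by (metis ocross.scaleR_right)
  moreover have "ocross (F p) (ocross (F p) (?A ?U)) = - ?A ?U"
    using ocross_twice[of "F p" "?A ?U"] AU F_S6[OF p]
    by (simp add: tanM_eq[OF p] S6_iff ImO_iff inner_commute)
  ultimately show ?thesis
    by (intro that[of "- (ocross (F p) (?A ?U) \<bullet> xi p)"]) (simp add: minus_equation_iff[of "?A ?U"])
qed

text \<open>The Hopf condition holds on a neighbourhood, hence can be differentiated there; this yields the
  assumption \<open>codazzi\<close> of the pointwise lemma, with \<open>f\<close>, \<open>n\<close> and \<open>g\<close> of \<open>deriv_of_proportional_forms\<close>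
  being \<open>F\<close>, \<open>xi\<close> and \<open>F \<times> xi\<close> in a chart.\<close>

lemma anticommuting_imp_shape_op_zero:
  assumes LC: "levi_civita_S6 nabla"
    and anti: "\<And>p v. p \<in> W \<Longrightarrow> v \<in> tanM Atl F p \<Longrightarrow> shape_op nabla T Atl F xi p (phi Atl F xi p v)
          + phi Atl F xi p (shape_op nabla T Atl F xi p v) = 0"
    and p: "p \<in> W" and v: "v \<in> tanM Atl F p"
  shows "shape_op nabla T Atl F xi p v = 0"
proof -
  let ?A = "shape_op nabla T Atl F xi p" and ?x = "F p" and ?n = "xi p"
  let ?T = "{v \<in> ImO. v \<bullet> ?x = 0 \<and> v \<bullet> ?n = 0}"
  let ?D = "{v \<in> ?T. v \<bullet> ocross ?x ?n = 0}"
  note T = tanM_eq[OF p]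
  note U = J_xi[OF p]
  obtain \<alpha> where \<alpha>: "?A (ocross ?x ?n) = \<alpha> *\<^sub>R ocross ?x ?n"
    by (rule anticommuting_imp_hopf[OF LC p anti[OF p]])
  obtain c where c: "c \<in> Atl" "p \<in> fst c"
    using chart_exists[OF p] .
  have A_D: "?A X \<in> ?D" if "X \<in> ?D" for X
    using shape_op_tangent[OF LC p, of X] shape_op_symmetric[OF LC p _ U(1), of X] \<alpha> that
    by (simp add: T)
  have phi_D: "phi Atl F xi p X = ocross ?x X" if "X \<in> ?D" for X
    using phi_eq[OF p, of X] inner_ocross_move_left[of ?x X ?n] that by (simp add: T)
  have A_J: "?A (ocross ?x X) = - ocross ?x (?A X)" if "X \<in> ?D" for X
    using anti[OF p, of X] phi_D[OF that] phi_D[OF A_D[OF that]] that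
    by (simp add: T add_eq_0_iff2)
  obtain V1 where V1: "open V1" "snd c p \<in> V1" "\<And>k. Ck_on k (in_chart c F) V1"
    using smooth_in_chart[OF manifold c(1) openin_topspace smooth_F c(2), OF subsetD[OF W_subset p]] by metis
  obtain V2 where V2: "open V2" "snd c p \<in> V2" "V2 \<subseteq> snd c ` (fst c \<inter> W)" "\<And>k. Ck_on k (in_chart c xi) V2"
    using smooth_in_chart[OF manifold c(1) open_W smooth_xi c(2) p] by metis
  define V where "V = V1 \<inter> V2"
  have V: "open V" "snd c p \<in> V" "Ck_on k (in_chart c F) V" "Ck_on k (in_chart c xi) V" for k
    using V1 V2 Ck_on_subset[of k "in_chart c F" V1 V] Ck_on_subset[of k "in_chart c xi" V2 V]
    by (auto simp: V_def)
  let ?g = "\<lambda>y. ocross (in_chart c F y) (in_chart c xi y)"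
  let ?g' = "\<lambda>u. ocross ?x (d_chart c xi p u) + ocross (d_chart c F p u) ?n"
  have g': "(?g has_derivative ?g') (at (snd c p))"
    using ocross.FDERIV[OF F_has_derivative[OF c p] xi_has_derivative[OF c p]]
    by (simp add: in_chart_apply[OF manifold c])
  have proportional: "(frechet_derivative (in_chart c xi) (at y) u \<bullet> ?g y) * (frechet_derivative (in_chart c F) (at y) w \<bullet> ?g y)
        = (frechet_derivative (in_chart c xi) (at y) w \<bullet> ?g y) * (frechet_derivative (in_chart c F) (at y) u \<bullet> ?g y)"
    if "y \<in> V" for y u w
  proof -
    obtain q where q: "q \<in> fst c" "q \<in> W" "y = snd c q"
      using \<open>y \<in> V\<close> V2(3) by (auto simp: V_def)
    note ap = in_chart_apply[OF manifold c(1) q(1)]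
    obtain \<beta> where \<beta>: "shape_op nabla T Atl F xi q (ocross (F q) (xi q)) = \<beta> *\<^sub>R ocross (F q) (xi q)"
      by (rule anticommuting_imp_hopf[OF LC q(2) anti[OF q(2)]])
    have "d_chart c xi q e \<bullet> ocross (F q) (xi q) = - \<beta> * (d_chart c F q e \<bullet> ocross (F q) (xi q))" for e
    proof -
      have "d_chart c F q e \<in> tanM Atl F q"
        using range_dF[OF c(1) q(1,2)] tanM_eq[OF q(2)] by blast
      from shape_op_symmetric[OF LC q(2) this J_xi(1)[OF q(2)]] show ?thesis
        by (simp add: shape_op_eq[OF LC c(1) q(1,2)] \<beta>)
    qed
    then show ?thesis
      by (simp add: q(3) ap d_chart_def[symmetric])
  qed
  have codazzi: "?A Y \<bullet> ocross X ?n - ?A X \<bullet> ocross Y ?n + 2 * (?A X \<bullet> ocross ?x (?A Y))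
        = - 2 * \<alpha> * (X \<bullet> ocross Y ?n)" if X: "X \<in> ?D" and Y: "Y \<in> ?D" for X Y
  proof -
    obtain a b w where ab: "X = d_chart c F p a" "Y = d_chart c F p b" "ocross ?x ?n = d_chart c F p w"
      using tanM_chartE[OF c p, of X] tanM_chartE[OF c p, of Y] tanM_chartE[OF c p U(1)] X Y
      unfolding T by (metis (no_types, lifting) mem_Collect_eq)
    have A: "?A X = - d_chart c xi p a" "?A Y = - d_chart c xi p b"
        "\<alpha> *\<^sub>R ocross ?x ?n = - d_chart c xi p w"
      using shape_op_eq[OF LC c p] \<alpha> by (simp_all add: ab)
    have fr: "frechet_derivative (in_chart c f) (at (snd c p)) = d_chart c f p" for f :: "'a \<Rightarrow> oct"
      by (simp add: d_chart_def fun_eq_iff)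
    have perp: "d_chart c F p a \<bullet> ocross ?x ?n = 0" "d_chart c F p b \<bullet> ocross ?x ?n = 0"
        "d_chart c F p w \<bullet> ocross ?x ?n = 1"
      using X Y U(3) by (simp_all add: ab)
    \<comment> \<open>The factor on the right is \<open>\<langle>- A U, U\<rangle> = - \<alpha>\<close>.\<close>
    have "d_chart c xi p a \<bullet> ?g' b - d_chart c xi p b \<bullet> ?g' a
      = (d_chart c xi p w \<bullet> ocross ?x ?n) * (d_chart c F p a \<bullet> ?g' b - d_chart c F p b \<bullet> ?g' a)"
      using deriv_of_proportional_forms[OF V(1,2) V(3,4) g' proportional, of a b w] perp
      by (simp add: fr in_chart_apply[OF manifold c])
    moreover have "d_chart c xi p a = - ?A X" "d_chart c xi p b = - ?A Y" "d_chart c xi p w = - \<alpha> *\<^sub>R ocross ?x ?n"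
      using A by simp_all
    ultimately have "- (?A X \<bullet> (ocross Y ?n - ocross ?x (?A Y))) + ?A Y \<bullet> (ocross X ?n - ocross ?x (?A X))
      = - \<alpha> * (X \<bullet> (ocross Y ?n - ocross ?x (?A Y)) - Y \<bullet> (ocross X ?n - ocross ?x (?A X)))"
      using U(3) by (simp add: ab(1,2)[symmetric] ocross.minus_right algebra_simps)
    moreover have "?A Y \<bullet> ocross ?x (?A X) = - (?A X \<bullet> ocross ?x (?A Y))"
      using inner_ocross_move_left[of ?x "?A Y" "?A X"] by (simp add: inner_commute)
    moreover have "Y \<bullet> ocross ?x (?A X) = X \<bullet> ocross ?x (?A Y)"
    proof -
      have "ocross ?x Y \<in> tanM Atl F p"
        using Y inner_ocross_move_left[of ?x Y ?x] inner_ocross_move_left[of ?x Y ?n] by (simp add: T ocross_in_ImO ocross_self)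
      then have "?A X \<bullet> ocross ?x Y = X \<bullet> ?A (ocross ?x Y)"
        using X by (intro shape_op_symmetric[OF LC p]) (auto simp: T)
      then show ?thesis
        using A_J[OF Y] inner_ocross_move_left[of ?x "?A X" Y] by (simp add: inner_commute)
    qed
    moreover have "Y \<bullet> ocross X ?n = - (X \<bullet> ocross Y ?n)"
      using inner_ocross_move_left[of Y X ?n] ocross_antisym[of X ?n] inner_ocross_cyclic[of X ?n Y] inner_ocross_cyclic[of ?n Y X]
        ocross_antisym[of ?n Y] by (simp add: inner_commute)
    ultimately show ?thesis
      by (simp add: inner_diff_right algebra_simps)
  qed
  show ?thesis
  proof (rule anticommuting_shape_vanishes[of ?x ?n ?A \<alpha> v])
    show "?x \<in> ImO" "?x \<bullet> ?x = 1" "?n \<in> ImO" "?n \<bullet> ?n = 1" "?x \<bullet> ?n = 0"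
      using F_S6[OF p] xi_unit[OF p] by (simp_all add: S6_iff ImO_iff inner_commute)
    show "?A w \<in> ?T" if "w \<in> ?T" for w
      using shape_op_tangent[OF LC p] that by (simp add: T)
    show "?A w \<bullet> w' = w \<bullet> ?A w'" if "w \<in> ?T" "w' \<in> ?T" for w w'
      using shape_op_symmetric[OF LC p, of w w'] that by (simp add: T)
    show "v \<in> ?T"
      using v by (simp add: T)
  qed (use \<alpha> A_J codazzi in \<open>simp_all\<close>)
qed

end

theorem theorem1p2:
  fixes T :: "'a topology"
    and Atl :: "('a, real^5) chart set"
    and F :: "'a \<Rightarrow> oct"
    and nabla :: "(oct \<Rightarrow> oct) \<Rightarrow> (oct \<Rightarrow> oct) \<Rightarrow> oct \<Rightarrow> oct"
  assumes "levi_civita_S6 nabla"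
    and "hypersurface_S6 T Atl F"
  shows "anticommuting nabla T Atl F \<longleftrightarrow> totally_geodesic nabla T Atl F"
proof
  assume anti: "anticommuting nabla T Atl F"
  show "totally_geodesic nabla T Atl F"
    unfolding totally_geodesic_def
  proof (intro allI impI ballI)
    fix W xi p v
    assume W: "unit_normal_on T Atl F W xi" and pv: "p \<in> W" "v \<in> tanM Atl F p"
    interpret hypersurface_with_normal T Atl F W xi
      using assms(2) W by unfold_locales
    show "shape_op nabla T Atl F xi p v = 0"
      by (rule anticommuting_imp_shape_op_zero[OF assms(1) _ pv])
        (use anti W in \<open>auto simp: anticommuting_def\<close>)
  qed
next
  assume geo: "totally_geodesic nabla T Atl F"
  show "anticommuting nabla T Atl F"
    unfolding anticommuting_def
  proof (intro allI impI ballI)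
    fix W xi p v
    assume W: "unit_normal_on T Atl F W xi" and p: "p \<in> W" and v: "v \<in> tanM Atl F p"
    interpret hypersurface_with_normal T Atl F W xi
      using assms(2) W by unfold_locales
    have A0: "shape_op nabla T Atl F xi p w = 0" if "w \<in> tanM Atl F p" for w
      using geo W p that unfolding totally_geodesic_def by blast
    have zero: "0 \<in> tanM Atl F p"
      by (simp add: tanM_eq[OF p] ImO_iff)
    have "phi Atl F xi p v \<in> tanM Atl F p"
      unfolding phi_eq[OF p v] using xi_unit[OF p] ocross_in_ImO[of "F p" v]
      by (simp add: tanM_eq[OF p] ImO_iff inner_diff_left ocross_orthogonal)
    then show "shape_op nabla T Atl F xi p (phi Atl F xi p v) + phi Atl F xi p (shape_op nabla T Atl F xi p v) = 0"
      using A0 v phi_eq[OF p zero] by (simp add: ocross.zero_right)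
  qed
qed

end
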